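(* Let $G=(V,E,w)$ be a weighted graph that admits a $(\Delta,\gamma,w)$-buffered cop decomposition with $\gamma\le\Delta$. Then for every $q\ge1$, $G$ admits a strong $\left(4\cdot(\frac{2\Delta}{q\cdot\gamma}+1),~\binom{w+2q-1}{w}\cdot4\cdot w\cdot(2+\frac{q\cdot\gamma}{\Delta}),~2\cdot(2\Delta+q\cdot\gamma)\right)$-sparse partition cover.
   Context: A supernode $\eta\subseteq V$ with skeleton $T_\eta$ (a tree in $G[\eta]$) and radius $\Delta$ is such that every vertex of $\eta$ is within distance $\Delta$ of $T_\eta$ in $G[\eta]$. A buffered cop decomposition is a partition of $V$ into vertex-disjoint supernodes with a rooted partition tree $\mathcal{T}$ on the supernodes; $\mathrm{dom}(\eta)$ is the subgraph induced by the union of supernodes in the subtree of $\mathcal{T}$ rooted at $\eta$. It is a $(\Delta,\gamma,w)$-buffered cop decomposition if: (i) every supernode has radius at most $\Delta$; (ii) for every $\eta$, letting $\mathcal{A}_\eta$ be the set of ancestors $\eta'$ of $\eta$ such that some edge joins $\mathrm{dom}(\eta)$ to $\eta'$, $|\mathcal{A}_\eta|\le w$, $T_\eta$ is a single-source shortest path tree in $\mathrm{dom}(\eta)$ with at most $w$ leaves (root not counted), and for every $\eta'\in\mathcal{A}_\eta$ some edge joins $T_\eta$ to $\eta'$; (iii) for every $\eta$ and every ancestor $\eta'$, either $\eta,\eta'$ are adjacent in $G$ or $d_{\mathrm{dom}(\eta')}(v,\eta')>\gamma$ for all $v\in\mathrm{dom}(\eta)$. A strong $(\beta,s,\Delta')$-sparse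 partition cover is a family of $s$ partitions $\mathcal{P}_1,\dots,\mathcal{P}_s$ of $V$ whose clusters $C$ all have strong diameter $\max_{u,v\in C}d_{G[C]}(u,v)\le\Delta'$, such that for every $v\in V$ the ball $B_G(v,\Delta'/\beta)$ is contained in some cluster (so each vertex lies in at most $s$ clusters).
   Formalization: Added: every edge of G joins vertices of the same supernode or of supernodes that are ancestor and descendant in the partition tree (else an expander plus a root with heavy edges is a counterexample); w ≥ 1 (for w = 0 the claim gives 0 partitions); and γ > 0. *)

theory Defs
  imports "Graph_Theory.Graph_Theory" "HOL-Library.Disjoint_Sets"
begin

text \<open>
  Finite simple undirected graphs are the symmetric pair digraphs \<^locale>\<open>pair_graph\<close> of
  \<^theory>\<open>Graph_Theory.Pair_Digraph\<close>: an undirected edge is a pair of opposite arcs,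
  which carry the same weight.
\<close>

locale weighted_graph = pair_graph G for G :: "'a pair_pre_digraph" +
  fixes wt :: "('a \<times> 'a) weight_fun"
  assumes wt_sym: "(u, v) \<in> parcs G \<Longrightarrow> wt (u, v) = wt (v, u)"
    and wt_nonneg: "e \<in> parcs G \<Longrightarrow> 0 \<le> wt e"

text \<open>Distances are extended reals; the distance between different components is infinite.\<close>

abbreviation gdist :: "('a, 'b) pre_digraph \<Rightarrow> 'b weight_fun \<Rightarrow> 'a \<Rightarrow> 'a \<Rightarrow> ereal" where
  "gdist H wt u v \<equiv> wf_digraph.\<mu> H wt u v"

definition gdist_set :: "('a, 'b) pre_digraph \<Rightarrow> 'b weight_fun \<Rightarrow> 'a \<Rightarrow> 'a set \<Rightarrow> ereal" where
  "gdist_set H wt v X = (INF x\<in>X. gdist H wt v x)"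

definition gball :: "('a, 'b) pre_digraph \<Rightarrow> 'b weight_fun \<Rightarrow> 'a \<Rightarrow> real \<Rightarrow> 'a set" where
  "gball H wt v r = {u \<in> verts H. gdist H wt v u \<le> ereal r}"

definition joined :: "'a pair_pre_digraph \<Rightarrow> 'a set \<Rightarrow> 'a set \<Rightarrow> bool" where
  "joined G A B \<longleftrightarrow> (\<exists>u\<in>A. \<exists>v\<in>B. (u, v) \<in> parcs G)"


section \<open>Rooted trees\<close>

text \<open>
  Rooted trees are out-arborescences: every edge is represented only by the arc pointing away
  from the root. (The constant \<^const>\<open>tree\<close> only excludes directed cycles and is therefore
  not suitable.) Hence \<open>y\<close> lies in the subtree rooted at \<open>x\<close> iff \<open>y\<close> is reachable from \<open>x\<close>.
\<close>

definition rooted_tree :: "'v \<Rightarrow> 'v pair_pre_digraph \<Rightarrow> bool" where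
  "rooted_tree r T \<longleftrightarrow> pair_wf_digraph T \<and> r \<in> pverts T \<and>
     (\<forall>v \<in> pverts T. \<exists>!p. pre_digraph.awalk (with_proj T) r p v)"

definition leaves :: "'v \<Rightarrow> 'v pair_pre_digraph \<Rightarrow> 'v set" where
  "leaves r T = {v \<in> pverts T. v \<noteq> r \<and> (\<forall>u. (v, u) \<notin> parcs T)}"

definition strict_ancestor :: "'v pair_pre_digraph \<Rightarrow> 'v \<Rightarrow> 'v \<Rightarrow> bool" where
  "strict_ancestor T x y \<longleftrightarrow> x \<rightarrow>\<^sup>+\<^bsub>with_proj T\<^esub> y"

text \<open>A shortest path tree need not span \<open>H\<close>; it preserves the distances from its root.\<close>

definition sssp_tree ::
    "('a, 'a \<times> 'a) pre_digraph \<Rightarrow> ('a \<times> 'a) weight_fun \<Rightarrow> 'a \<Rightarrow> 'a pair_pre_digraph \<Rightarrow> bool" where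
  "sssp_tree H wt r T \<longleftrightarrow> rooted_tree r T \<and> subgraph (with_proj T) H \<and>
     (\<forall>v \<in> pverts T. gdist (with_proj T) wt r v = gdist H wt r v)"


section \<open>Buffered cop decompositions\<close>

text \<open>The supernode with vertex set \<open>\<eta>\<close> has skeleton \<open>T\<close>, rooted at \<open>r\<close>, and radius at most \<open>\<Delta>\<close>.\<close>

definition supernode ::
    "'a pair_pre_digraph \<Rightarrow> ('a \<times> 'a) weight_fun \<Rightarrow> real \<Rightarrow> 'a set \<Rightarrow> 'a \<Rightarrow> 'a pair_pre_digraph \<Rightarrow> bool"
  where
  "supernode G wt \<Delta> \<eta> r T \<longleftrightarrow> \<eta> \<subseteq> pverts G \<and>
     rooted_tree r T \<and> subgraph (with_proj T) (with_proj G \<restriction> \<eta>) \<and>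
     (\<forall>v\<in>\<eta>. gdist_set (with_proj G \<restriction> \<eta>) wt v (pverts T) \<le> ereal \<Delta>)"

definition dom_verts :: "'a set pair_pre_digraph \<Rightarrow> 'a set \<Rightarrow> 'a set" where
  "dom_verts \<T> \<eta> = \<Union>{\<eta>'. \<eta> \<rightarrow>\<^sup>*\<^bsub>with_proj \<T>\<^esub> \<eta>'}"

definition domain_graph ::
    "'a pair_pre_digraph \<Rightarrow> 'a set pair_pre_digraph \<Rightarrow> 'a set \<Rightarrow> ('a, 'a \<times> 'a) pre_digraph" where
  "domain_graph G \<T> \<eta> = with_proj G \<restriction> dom_verts \<T> \<eta>"

definition adj_ancestors :: "'a pair_pre_digraph \<Rightarrow> 'a set pair_pre_digraph \<Rightarrow> 'a set \<Rightarrow> 'a set set"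
  where
  "adj_ancestors G \<T> \<eta> = {\<eta>'. strict_ancestor \<T> \<eta>' \<eta> \<and> joined G (dom_verts \<T> \<eta>) \<eta>'}"

text \<open>
  The nodes of the partition tree are the supernodes. The last condition says that the domains
  of different children of a node are not joined by edges. It is part of the notion of a
  partition tree of a cop decomposition: after a supernode is removed, the remaining components
  are treated separately, and an edge of the graph never joins two supernodes that are unrelated
  in the tree. Without it, every graph with an additional root vertex joined to everything by
  heavy edges would have a decomposition into singletons, for all \<open>\<Delta>\<close>, \<open>\<gamma>\<close> and width 1.
\<close>

definition partition_tree :: "'a pair_pre_digraph \<Rightarrow> 'a set \<Rightarrow> 'a set pair_pre_digraph \<Rightarrow> bool" where
  "partition_tree G \<rho> \<T> \<longleftrightarrow> rooted_tree \<rho> \<T> \<and> partition_on (pverts G) (pverts \<T>) \<and>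
     (\<forall>\<eta>\<in>pverts \<T>. \<forall>\<eta>'\<in>pverts \<T>. joined G \<eta> \<eta>' \<longrightarrow>
        \<eta> = \<eta>' \<or> strict_ancestor \<T> \<eta> \<eta>' \<or> strict_ancestor \<T> \<eta>' \<eta>)"

text \<open>\<open>sk \<eta>\<close> is the skeleton of the supernode \<open>\<eta>\<close> and \<open>rt \<eta>\<close> is the root of this skeleton.\<close>

definition buffered_cop_decomposition ::
    "'a pair_pre_digraph \<Rightarrow> ('a \<times> 'a) weight_fun \<Rightarrow> real \<Rightarrow> real \<Rightarrow> nat \<Rightarrow>
     'a set \<Rightarrow> 'a set pair_pre_digraph \<Rightarrow> ('a set \<Rightarrow> 'a) \<Rightarrow> ('a set \<Rightarrow> 'a pair_pre_digraph) \<Rightarrow> bool"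
  where
  "buffered_cop_decomposition G wt \<Delta> \<gamma> w \<rho> \<T> rt sk \<longleftrightarrow>
     partition_tree G \<rho> \<T> \<and>
     (\<forall>\<eta>\<in>pverts \<T>. supernode G wt \<Delta> \<eta> (rt \<eta>) (sk \<eta>)) \<and>
     (\<forall>\<eta>\<in>pverts \<T>.
        card (adj_ancestors G \<T> \<eta>) \<le> w \<and>
        sssp_tree (domain_graph G \<T> \<eta>) wt (rt \<eta>) (sk \<eta>) \<and>
        card (leaves (rt \<eta>) (sk \<eta>)) \<le> w \<and>
        (\<forall>\<eta>'\<in>adj_ancestors G \<T> \<eta>. joined G (pverts (sk \<eta>)) \<eta>')) \<and>
     (\<forall>\<eta>\<in>pverts \<T>. \<forall>\<eta>'\<in>pverts \<T>. strict_ancestor \<T> \<eta>' \<eta> \<longrightarrow>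
        joined G \<eta> \<eta>' \<or>
        (\<forall>v\<in>dom_verts \<T> \<eta>. gdist_set (domain_graph G \<T> \<eta>') wt v \<eta>' > ereal \<gamma>))"

definition admits_buffered_cop_decomposition ::
    "'a pair_pre_digraph \<Rightarrow> ('a \<times> 'a) weight_fun \<Rightarrow> real \<Rightarrow> real \<Rightarrow> nat \<Rightarrow> bool" where
  "admits_buffered_cop_decomposition G wt \<Delta> \<gamma> w \<longleftrightarrow>
     (\<exists>\<rho> \<T> rt sk. buffered_cop_decomposition G wt \<Delta> \<gamma> w \<rho> \<T> rt sk)"


section \<open>Sparse partition covers\<close>

definition strong_diameter ::
    "'a pair_pre_digraph \<Rightarrow> ('a \<times> 'a) weight_fun \<Rightarrow> 'a set \<Rightarrow> ereal" where
  "strong_diameter G wt C = (SUP u\<in>C. SUP v\<in>C. gdist (with_proj G \<restriction> C) wt u v)"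

text \<open>
  The bound \<open>s\<close> is real-valued, so the number of partitions is its integer part. The list \<open>Ps\<close> is
  an indexed family; repetitions are allowed.
\<close>

definition strong_sparse_partition_cover ::
    "'a pair_pre_digraph \<Rightarrow> ('a \<times> 'a) weight_fun \<Rightarrow> real \<Rightarrow> real \<Rightarrow> real \<Rightarrow> 'a set set list \<Rightarrow> bool"
  where
  "strong_sparse_partition_cover G wt \<beta> s \<Delta>' Ps \<longleftrightarrow>
     length Ps = nat \<lfloor>s\<rfloor> \<and>
     (\<forall>P\<in>set Ps. partition_on (pverts G) P) \<and>
     (\<forall>P\<in>set Ps. \<forall>C\<in>P. strong_diameter G wt C \<le> ereal \<Delta>') \<and>
     (\<forall>v\<in>pverts G. \<exists>P\<in>set Ps. \<exists>C\<in>P. gball (with_proj G) wt v (\<Delta>' / \<beta>) \<subseteq> C)"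

definition admits_strong_sparse_partition_cover ::
    "'a pair_pre_digraph \<Rightarrow> ('a \<times> 'a) weight_fun \<Rightarrow> real \<Rightarrow> real \<Rightarrow> real \<Rightarrow> bool" where
  "admits_strong_sparse_partition_cover G wt \<beta> s \<Delta>' \<longleftrightarrow>
     (\<exists>Ps. strong_sparse_partition_cover G wt \<beta> s \<Delta>' Ps)"

end

theory Submission
  imports Defs
begin

text \<open>
  Let \<open>r = q \<gamma>\<close>; the balls to be covered have radius \<open>r/2\<close>. If \<open>\<eta>\<close> is the topmost supernode meeting
  such a ball, then the ball lies in the neighbourhood \<open>N(\<eta>)\<close> of radius \<open>r\<close> around \<open>\<eta>\<close> in \<open>dom(\<eta>)\<close>.
  On each root-to-leaf path of the skeleton choose one vertex from every distance interval
  \<open>[k \<Delta>, (k + 1) \<Delta>)\<close>; the ball lies in the ball of radius \<open>2 \<Delta> + r\<close> in \<open>G[N(\<eta>)]\<close> around one of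
  these net points, and those balls are the clusters. Two clusters of the same path are disjoint if
  their indices \<open>k\<close> differ by at least \<open>5 + 2 r/\<Delta>\<close>, because skeleton paths are shortest paths in
  \<open>dom(\<eta>)\<close>; so it suffices to separate the clusters by leaf, by \<open>k\<close> modulo a constant, and by a
  colouring of the supernodes in which \<open>N(\<eta>)\<close> and \<open>N(\<eta>')\<close> are disjoint whenever \<open>\<eta> \<noteq> \<eta>'\<close> have
  the same colour.

  For the colouring, let \<open>\<eta>'\<close> be an ancestor of \<open>\<eta>\<close> whose neighbourhood meets \<open>N(\<eta>)\<close>. A walk of
  length at most \<open>q \<gamma>\<close> from \<open>dom(\<eta>)\<close> to \<open>\<eta>'\<close> climbs along the relation \<open>\<zeta> \<in> \<A>\<^sub>\<xi>\<close>, and by the buffer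
  property any two consecutive steps that cannot be shortcut cost more than \<open>\<gamma>\<close>. Hence \<open>\<eta>'\<close> is
  reached in at most \<open>2 q - 1\<close> steps. As in the bound on the weak colouring numbers of graphs of
  treewidth \<open>w\<close>, at most \<open>(w + 2 q - 1) choose w\<close> supernodes, \<open>\<eta>\<close> included, are reached in this
  way, so greedy colouring from the root downwards needs no more colours than that.
\<close>

section \<open>Bounded reachability and colouring\<close>

definition reach_upto :: "('b \<times> 'b) set \<Rightarrow> nat \<Rightarrow> 'b \<Rightarrow> 'b set" where
  "reach_upto R r x = {y. \<exists>i\<le>r. (x, y) \<in> R ^^ i}"

lemma reach_upto_0 [simp]: "reach_upto R 0 x = {x}"
  by (auto simp: reach_upto_def)

lemma reach_upto_no_succ:
  assumes "R `` {x} = {}"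
  shows "reach_upto R r x = {x}"
proof -
  have "y = x" if "(x, y) \<in> R ^^ i" for i y
    using that assms by (cases i) (auto elim: relpow_E2)
  then show ?thesis by (auto simp: reach_upto_def intro: exI[of _ 0])
qed

text \<open>A finite chain has a maximal element, and comparability makes it the greatest one. Pairs
  of \<open>anc\<close> point upwards, so \<open>c\<close> is the top of \<open>A\<close>.\<close>

lemma finite_linear_top:
  assumes "finite A" "A \<noteq> {}" "trans anc" "irrefl anc"
    and "\<And>a b. a \<in> A \<Longrightarrow> b \<in> A \<Longrightarrow> a = b \<or> (a, b) \<in> anc \<or> (b, a) \<in> anc"
  obtains c where "c \<in> A" "\<And>a. a \<in> A \<Longrightarrow> a \<noteq> c \<Longrightarrow> (a, c) \<in> anc"
proof -
  have "acyclic anc"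
    using assms(3,4) by (simp add: acyclic_irrefl)
  then have "acyclic ((anc \<inter> A \<times> A)\<inverse>)"
    by (auto intro: acyclic_subset)
  moreover have "finite ((anc \<inter> A \<times> A)\<inverse>)"
    using assms(1) by auto
  ultimately have "wf ((anc \<inter> A \<times> A)\<inverse>)"
    by (rule finite_acyclic_wf[rotated])
  then obtain c where "c \<in> A" "\<And>y. (y, c) \<in> (anc \<inter> A \<times> A)\<inverse> \<Longrightarrow> y \<notin> A"
    using assms(2) by (metis wfE_min ex_in_conv)
  then show ?thesis
    using assms(5) that by blast
qed

text \<open>
  Pascal's rule: let \<open>c\<close> be the topmost \<open>R\<close>-successor of \<open>x\<close>. A path from \<open>x\<close> that stays strictly below
  \<open>c\<close> uses only successors other than \<open>c\<close>, which lowers the degree; a path that does not can be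
  rerouted through \<open>c\<close>, from where at most \<open>r - 1\<close> steps remain.
\<close>

lemma card_reach_upto:
  assumes anc: "trans anc" "irrefl anc"
    and lin: "\<And>x a b. (x, a) \<in> anc \<Longrightarrow> (x, b) \<in> anc \<Longrightarrow> a = b \<or> (a, b) \<in> anc \<or> (b, a) \<in> anc"
  shows "R \<subseteq> anc
    \<Longrightarrow> (\<And>x a b. (x, a) \<in> R \<Longrightarrow> (x, b) \<in> anc \<Longrightarrow> (b, a) \<in> anc \<Longrightarrow> (b, a) \<in> R)
    \<Longrightarrow> (\<And>b. (x, b) \<in> R\<^sup>* \<Longrightarrow> finite (R `` {b}) \<and> card (R `` {b}) \<le> w)
    \<Longrightarrow> finite (reach_upto R r x) \<and> card (reach_upto R r x) \<le> (w + r) choose w"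
proof (induction "w + r" arbitrary: w r x R rule: less_induct)
  case (less w r x R)
  show ?case
  proof (cases "r = 0 \<or> R `` {x} = {}")
    case True
    then have "reach_upto R r x = {x}"
      using reach_upto_no_succ by (metis reach_upto_0)
    then show ?thesis
      by (simp add: Suc_leI zero_less_binomial)
  next
    case False
    have fin: "finite (R `` {x})" and card: "card (R `` {x}) \<le> w"
      using less.prems(3)[of x] by auto
    have linx: "\<And>a b. a \<in> R `` {x} \<Longrightarrow> b \<in> R `` {x} \<Longrightarrow> a = b \<or> (a, b) \<in> anc \<or> (b, a) \<in> anc"
      using less.prems(1) lin by blast
    obtain c where c: "c \<in> R `` {x}" "\<And>a. a \<in> R `` {x} \<Longrightarrow> a \<noteq> c \<Longrightarrow> (a, c) \<in> anc"
      using finite_linear_top[OF fin _ anc] linx False by blast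
    obtain r' where r': "r = Suc r'"
      using False by (cases r) auto
    obtain w' where w': "w = Suc w'"
      using c(1) card fin by (cases w) auto
    define R' where "R' = {(a, b) \<in> R. (b, c) \<in> anc}"
    have anc': "\<And>a b d. (a, b) \<in> anc \<Longrightarrow> (b, d) \<in> anc \<Longrightarrow> (a, d) \<in> anc"
      using anc(1) by (meson transD)
    have xc: "(x, c) \<in> R" using c(1) by simp
    have below: "b = x \<or> ((x, b) \<in> anc \<and> (b, c) \<in> anc)" if "(x, b) \<in> R'\<^sup>*" for b
      using that
    proof induction
      case (step y z)
      then show ?case using less.prems(1) anc' unfolding R'_def by blast
    qed simp
    have split: "(x, y) \<in> R' ^^ i \<or> (\<exists>j<i. (c, y) \<in> R ^^ j)" if "(x, y) \<in> R ^^ i" for i y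
      using that
    proof (induction i arbitrary: y)
      case (Suc i)
      from Suc.prems obtain z where z: "(x, z) \<in> R ^^ i" "(z, y) \<in> R" by auto
      show ?case
      proof (cases "\<exists>j<i. (c, z) \<in> R ^^ j")
        case True
        then obtain j where "j < i" "(c, z) \<in> R ^^ j" by blast
        then have "Suc j < Suc i \<and> (c, y) \<in> R ^^ Suc j" using z(2) by auto
        then show ?thesis by blast
      next
        case False
        then have R'i: "(x, z) \<in> R' ^^ i" using Suc.IH[OF z(1)] by blast
        then have "(x, z) \<in> R'\<^sup>*" by (rule relpow_imp_rtrancl)
        note b = below[OF this]
        have xy: "(x, y) \<in> anc" using b z(2) less.prems(1) anc' by blast
        consider "(y, c) \<in> anc" | "y = c" | "(c, y) \<in> anc"
          using lin[OF xy, of c] xc less.prems(1) by blast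
        then show ?thesis
        proof cases
          case 1
          then have "(z, y) \<in> R'" using z(2) by (auto simp: R'_def)
          then show ?thesis using R'i by auto
        next
          case 2
          then show ?thesis by (auto intro!: exI[of _ 0])
        next
          case 3
          \<comment> \<open>As \<open>c\<close> is the topmost successor of \<open>x\<close>, an arc
            from \<open>x\<close> itself cannot pass above \<open>c\<close>. So \<open>z\<close>
            lies strictly between \<open>x\<close> and \<open>c\<close>, and the closure hypothesis
            turns the arc from \<open>z\<close> to \<open>y\<close> into one from \<open>c\<close>
            to \<open>y\<close>.\<close>
          have "z \<noteq> x"
          proof
            assume "z = x"
            then have "y = c \<or> (y, c) \<in> anc" using c(2) z(2) by blast
            then show False using 3 anc' anc(2) by (meson irreflD)
          qed
          then have "i \<noteq> 0" using z(1) by (cases i) auto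
          moreover have "(c, y) \<in> R"
            using \<open>z \<noteq> x\<close> b z(2) 3 less.prems(2) by blast
          ultimately show ?thesis
            by (intro disjI2 exI[of _ 1]) simp
        qed
      qed
    qed simp
    have "reach_upto R r x \<subseteq> reach_upto R' r x \<union> reach_upto R r' c"
    proof
      fix y assume "y \<in> reach_upto R r x"
      then obtain i where "i \<le> r" "(x, y) \<in> R ^^ i" by (auto simp: reach_upto_def)
      then show "y \<in> reach_upto R' r x \<union> reach_upto R r' c"
        using split[of y i] r' unfolding reach_upto_def by fastforce
    qed
    moreover have "finite (reach_upto R' r x) \<and> card (reach_upto R' r x) \<le> (w' + r) choose w'"
    proof (rule less.hyps)
      show "R' \<subseteq> anc" using less.prems(1) by (auto simp: R'_def)
      show "(b, a) \<in> R'" if "(y, a) \<in> R'" "(y, b) \<in> anc" "(b, a) \<in> anc" for y a b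
        using that less.prems(2) by (auto simp: R'_def)
      show "finite (R' `` {b}) \<and> card (R' `` {b}) \<le> w'" if b: "(x, b) \<in> R'\<^sup>*" for b
      proof -
        have "(x, b) \<in> R\<^sup>*" using b rtrancl_mono[of R' R] by (auto simp: R'_def)
        then have fb: "finite (R `` {b})" "card (R `` {b}) \<le> w" using less.prems(3) by auto
        \<comment> \<open>By closure every vertex that \<open>R'\<close> reaches from
          \<open>x\<close> has \<open>c\<close> as an \<open>R\<close>-successor. \<open>R'\<close>
          drops this successor because \<open>anc\<close> is irreflexive, so the degree falls by
          one.\<close>
        have "(b, c) \<in> R" using below[OF b] xc less.prems(2) by blast
        then have "card (R `` {b} - {c}) < card (R `` {b})"
          using fb(1) by (intro card_Diff1_less) auto
        moreover have sub: "R' `` {b} \<subseteq> R `` {b} - {c}"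
          using anc(2) by (auto simp: R'_def irrefl_def)
        then have "card (R' `` {b}) \<le> card (R `` {b} - {c})"
          using fb(1) by (intro card_mono) auto
        ultimately show ?thesis using fb sub w' by (auto intro: finite_subset)
      qed
    qed (use w' in simp)
    moreover have "finite (reach_upto R r' c) \<and> card (reach_upto R r' c) \<le> (w + r') choose w"
    proof (rule less.hyps)
      show "finite (R `` {b}) \<and> card (R `` {b}) \<le> w" if "(c, b) \<in> R\<^sup>*" for b
        using that xc by (intro less.prems(3)) auto
    qed (use r' less.prems in auto)
    moreover have "(w + r) choose w = ((w' + r) choose w') + ((w + r') choose w)"
      using w' r' by simp
    ultimately show ?thesis
      by (smt (verit) card_mono card_Un_le finite_UnI finite_subset le_trans add_mono)
  qed
qed

text \<open>Well-founded recursion: fewer than \<open>K\<close> earlier neighbours cannot occupy all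
  \<open>K\<close> colours. The second goal of the choice rule says that the colour of
  \<open>x\<close> depends only on colours already chosen.\<close>

lemma greedy_colouring:
  assumes "wf W"
    and N: "\<And>x. finite (N x)" "\<And>x. card (N x) < K" "\<And>x y. y \<in> N x \<Longrightarrow> (y, x) \<in> W"
  shows "\<exists>f. \<forall>x. f x < K \<and> (\<forall>y\<in>N x. f y \<noteq> (f x :: nat))"
proof (rule dependent_wf_choice[OF \<open>wf W\<close>])
  show "\<exists>r<K. \<forall>y\<in>N x. f y \<noteq> r" for x and f :: "_ \<Rightarrow> nat"
  proof (rule ccontr)
    assume "\<not> ?thesis"
    then have "{..<K} \<subseteq> f ` N x" by auto
    then have "K \<le> card (f ` N x)" using N(1) by (metis card_lessThan card_mono finite_imageI)
    then show False using N(2)[of x] card_image_le[OF N(1), of f x] by simp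
  qed
next
  show "(r < K \<and> (\<forall>y\<in>N x. f y \<noteq> r)) = (r < K \<and> (\<forall>y\<in>N x. g y \<noteq> r))"
    if "\<And>z. (z, x) \<in> W \<Longrightarrow> f z = g z" for f g x and r :: nat
    using that N(3) by auto
qed

section \<open>Walks and distances\<close>

text \<open>Carrying the vertex set and the real length as arguments lets walks be cut, joined and
  moved between domains without arc lists or a change of graph.\<close>

inductive walk_in :: "'a pair_pre_digraph \<Rightarrow> ('a \<times> 'a) weight_fun \<Rightarrow> 'a set \<Rightarrow> 'a \<Rightarrow> 'a \<Rightarrow> real \<Rightarrow> bool"
  for G wt X where
  refl: "u \<in> X \<Longrightarrow> walk_in G wt X u u 0"
| step: "walk_in G wt X u v c \<Longrightarrow> (v, x) \<in> parcs G \<Longrightarrow> x \<in> X \<Longrightarrow> walk_in G wt X u x (c + wt (v, x))"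

lemma walk_in_ends: "walk_in G wt X u v c \<Longrightarrow> u \<in> X \<and> v \<in> X"
  by (induction rule: walk_in.induct) auto

lemma walk_in_mono:
  assumes "walk_in G wt X u v c" "X \<subseteq> Y"
  shows "walk_in G wt Y u v c"
  using assms by (induction rule: walk_in.induct) (auto intro: walk_in.intros)

lemma walk_in_trans:
  assumes "walk_in G wt X u v c" "walk_in G wt X v x d"
  shows "walk_in G wt X u x (c + d)"
  using assms(2,1)
  by (induction rule: walk_in.induct) (auto simp: add.assoc[symmetric] intro: walk_in.intros)

lemma walk_in_edge:
  assumes "(u, v) \<in> parcs G" "u \<in> X" "v \<in> X"
  shows "walk_in G wt X u v (wt (u, v))"
  using walk_in.step[OF walk_in.refl] assms by fastforce

text \<open>The walk is cut at its first arc leaving \<open>D\<close>; the remainder may return to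
  \<open>D\<close>. With a domain for \<open>D\<close>, the vertex \<open>b\<close> reveals the
  ancestor that the walk enters.\<close>

lemma walk_in_exit:
  assumes "walk_in G wt X u v c" "u \<in> D"
  shows "walk_in G wt (X \<inter> D) u v c \<or> (\<exists>a b c1 c2. walk_in G wt (X \<inter> D) u a c1 \<and>
     (a, b) \<in> parcs G \<and> b \<in> X - D \<and> walk_in G wt X b v c2 \<and> c = c1 + wt (a, b) + c2)"
  using assms
proof (induction rule: walk_in.induct)
  case (refl u)
  then show ?case by (auto intro: walk_in.refl)
next
  case (step u v c x)
  from step.IH[OF step.prems] show ?case
  proof
    assume w: "walk_in G wt (X \<inter> D) u v c"
    show ?thesis
    proof (cases "x \<in> D")
      case True
      then show ?thesis using w step.hyps by (auto intro: walk_in.step)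
    next
      case False
      then have "walk_in G wt X x x 0" "x \<in> X - D" using step.hyps by (auto intro: walk_in.refl)
      then show ?thesis using w step.hyps(2) by fastforce
    qed
  next
    assume "\<exists>a b c1 c2. walk_in G wt (X \<inter> D) u a c1 \<and> (a, b) \<in> parcs G \<and> b \<in> X - D \<and>
      walk_in G wt X b v c2 \<and> c = c1 + wt (a, b) + c2"
    then obtain a b c1 c2 where *: "walk_in G wt (X \<inter> D) u a c1" "(a, b) \<in> parcs G" "b \<in> X - D"
      "walk_in G wt X b v c2" "c = c1 + wt (a, b) + c2" by blast
    have "walk_in G wt X b x (c2 + wt (v, x))" using *(4) step.hyps by (auto intro: walk_in.step)
    then show ?thesis using * by (metis add.assoc)
  qed
qed

context weighted_graph begin

lemma walk_in_nonneg: "walk_in G wt X u v c \<Longrightarrow> 0 \<le> c"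
  by (induction rule: walk_in.induct) (auto intro: add_nonneg_nonneg wt_nonneg)

lemma walk_in_sym: "walk_in G wt X u v c \<Longrightarrow> walk_in G wt X v u c"
proof (induction rule: walk_in.induct)
  case (step u v c x)
  have "walk_in G wt X x v (wt (x, v))"
    using step walk_in_ends arcs_symmetric by (metis walk_in_edge)
  then show ?case
    using step wt_sym walk_in_trans by (metis add.commute)
qed (auto intro: walk_in.refl)

text \<open>Weights are nonnegative, so every prefix of a walk of length at most \<open>r\<close> is
  also that short. Hence a ball contains the short walks from its centre, which is what strong
  diameter requires.\<close>

lemma walk_in_ball:
  "walk_in G wt X u v c \<Longrightarrow> c \<le> r \<Longrightarrow> walk_in G wt {z. \<exists>d\<le>r. walk_in G wt X u z d} u v c"
proof (induction rule: walk_in.induct)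
  case (refl u)
  then show ?case by (auto intro!: walk_in.refl)
next
  case (step u v c x)
  have "0 \<le> wt (v, x)" using step.hyps(2) by (rule wt_nonneg)
  then have "walk_in G wt {z. \<exists>d\<le>r. walk_in G wt X u z d} u v c" using step by auto
  moreover have "walk_in G wt X u x (c + wt (v, x))" using step by (auto intro: walk_in.step)
  ultimately show ?case using step.hyps step.prems by (intro walk_in.step) auto
qed

section \<open>Walks versus distances in induced subgraphs\<close>

lemma awalk_walk_in:
  assumes "pre_digraph.awalk (with_proj G \<restriction> X) u p v"
  shows "walk_in G wt X u v (wf_digraph.awalk_cost wt p)"
proof -
  interpret H: wf_digraph "with_proj G \<restriction> X" by (rule wellformed_induce_subgraph)
  show ?thesis using assms
  proof (induction p arbitrary: u)
    case Nil
    then show ?case by (auto simp: H.awalk_Nil_iff intro: walk_in.refl)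
  next
    case (Cons e p)
    then have "walk_in G wt X (snd e) v (H.awalk_cost wt p)"
      "e \<in> parcs G" "fst e \<in> X" "snd e \<in> X" "u = fst e"
      by (auto simp: H.awalk_Cons_iff)
    then show ?case using walk_in_trans walk_in_edge
      by (metis H.awalk_cost_Cons prod.collapse)
  qed
qed

lemma walk_in_awalk:
  assumes "walk_in G wt X u v c"
  shows "\<exists>p. pre_digraph.awalk (with_proj G \<restriction> X) u p v \<and> wf_digraph.awalk_cost wt p = c"
proof -
  interpret H: wf_digraph "with_proj G \<restriction> X" by (rule wellformed_induce_subgraph)
  show ?thesis using assms
  proof (induction rule: walk_in.induct)
    case (refl u)
    then have "H.awalk u [] u" by (simp add: H.awalk_Nil_iff)
    then show ?case by fastforce
  next
    case (step u v c x)
    then obtain p where p: "H.awalk u p v" "H.awalk_cost wt p = c" by blast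
    have "H.awalk v [(v, x)] x"
      using step walk_in_ends[OF step.hyps(1)] by (auto simp: H.awalk_simps)
    then have "H.awalk u (p @ [(v, x)]) x" using p by (blast intro: H.awalk_appendI)
    then show ?case using p by (intro exI[of _ "p @ [(v, x)]"]) auto
  qed
qed

lemma gdist_le_walk:
  assumes "walk_in G wt X u v c"
  shows "gdist (with_proj G \<restriction> X) wt u v \<le> ereal c"
proof -
  interpret H: wf_digraph "with_proj G \<restriction> X" by (rule wellformed_induce_subgraph)
  show ?thesis using walk_in_awalk[OF assms] H.min_cost_le_walk_cost by blast
qed

text \<open>In a finite graph with nonnegative weights a finite distance is attained by a path, so
  the infimum can be replaced by an actual walk.\<close>

lemma gdist_le_iff:
  assumes "X \<subseteq> pverts G"
  shows "gdist (with_proj G \<restriction> X) wt u v \<le> ereal c \<longleftrightarrow> (\<exists>d\<le>c. walk_in G wt X u v d)"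
proof
  have "fin_digraph (with_proj G \<restriction> X)"
    using subgraph_induce_subgraphI[of X] assms fin_digraph_subgraph[of "with_proj G \<restriction> X"] by simp
  then interpret H: fin_digraph "with_proj G \<restriction> X" .
  assume le: "gdist (with_proj G \<restriction> X) wt u v \<le> ereal c"
  then have "H.\<mu> wt u v < \<infinity>" using le_less_trans[OF le, of \<infinity>] by simp
  then have "u \<rightarrow>\<^sup>*\<^bsub>with_proj G \<restriction> X\<^esub> v" by (rule H.\<mu>_reach_conv[THEN iffD1])
  then obtain p where p: "H.apath u p v" "H.\<mu> wt u v = H.awalk_cost wt p"
    using H.min_cost_awalk[of u v wt] wt_nonneg by auto
  then have "walk_in G wt X u v (H.awalk_cost wt p)"
    using awalk_walk_in by (auto simp: pre_digraph.apath_def)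
  then show "\<exists>d\<le>c. walk_in G wt X u v d" using p(2) le by auto
next
  assume "\<exists>d\<le>c. walk_in G wt X u v d"
  then show "gdist (with_proj G \<restriction> X) wt u v \<le> ereal c"
    using gdist_le_walk by (meson ereal_less_eq(3) order_trans)
qed

lemma gdist_set_le_walk:
  assumes "walk_in G wt X u v c" "v \<in> Y"
  shows "gdist_set (with_proj G \<restriction> X) wt u Y \<le> ereal c"
  unfolding gdist_set_def using gdist_le_walk[OF assms(1)] assms(2) by (meson INF_lower2)

lemma gdist_set_le_imp_walk:
  assumes "gdist_set (with_proj G \<restriction> X) wt u Y \<le> ereal c" "X \<subseteq> pverts G" "finite Y" "Y \<noteq> {}"
  obtains v d where "v \<in> Y" "d \<le> c" "walk_in G wt X u v d"
proof -
  have "gdist_set (with_proj G \<restriction> X) wt u Y \<in> gdist (with_proj G \<restriction> X) wt u ` Y"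
    unfolding gdist_set_def using assms(3,4) by (rule finite_INF_in)
  then show ?thesis using assms gdist_le_iff that by auto
qed

lemma gball_eq: "gball (with_proj G) wt v r = {u. \<exists>d\<le>r. walk_in G wt (pverts G) v u d}"
proof -
  have "with_proj G \<restriction> pverts G = with_proj G"
    by (auto simp: induce_subgraph_def with_proj_def intro: wellformed')
  then show ?thesis using gdist_le_iff[of "pverts G"] walk_in_ends by (fastforce simp: gball_def)
qed

text \<open>Two vertices of the ball are joined through the centre \<open>t\<close>, and
  \<open>walk_in_ball\<close> keeps both halves inside \<open>C\<close>.\<close>

lemma strong_diameter_ball:
  assumes S: "S \<subseteq> pverts G" and C: "C = {u. \<exists>d\<le>r. walk_in G wt S t u d}"
  shows "strong_diameter G wt C \<le> ereal (2 * r)"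
  unfolding strong_diameter_def
proof (intro SUP_least)
  fix u v assume "u \<in> C" "v \<in> C"
  then obtain d e where "d \<le> r" "walk_in G wt C t u d" "e \<le> r" "walk_in G wt C t v e"
    using walk_in_ball unfolding C by blast
  then have "d + e \<le> 2 * r" "walk_in G wt C u v (d + e)"
    by (auto intro: walk_in_trans walk_in_sym)
  then show "gdist (with_proj G \<restriction> C) wt u v \<le> ereal (2 * r)"
    using gdist_le_walk by (meson ereal_less_eq(3) order_trans)
qed

lemma strong_diameter_singleton:
  "strong_diameter G wt {v} \<le> 0"
  using gdist_le_walk[OF walk_in.refl, of v "{v}"] by (simp add: strong_diameter_def zero_ereal_def)

end

section \<open>Rooted trees\<close>

lemma rooted_tree_awalk:
  assumes "rooted_tree r T" "v \<in> pverts T"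
  obtains p where "pre_digraph.awalk (with_proj T) r p v"
  using assms unfolding rooted_tree_def by metis

lemma rooted_tree_unique_awalk:
  assumes "rooted_tree r T" "pre_digraph.awalk (with_proj T) r p v" "pre_digraph.awalk (with_proj T) r q v"
  shows "p = q"
proof -
  interpret pair_wf_digraph T using assms(1) by (simp add: rooted_tree_def)
  show ?thesis using assms awalk_last_in_verts[OF assms(2)] unfolding rooted_tree_def by metis
qed

text \<open>Extending the root walks of \<open>x\<close> and \<open>y\<close> to \<open>z\<close>
  yields the same walk by uniqueness, so one of the two is a prefix of the other.\<close>

lemma rooted_tree_linear:
  assumes T: "rooted_tree r T" and x: "x \<rightarrow>\<^sup>*\<^bsub>with_proj T\<^esub> z" and y: "y \<rightarrow>\<^sup>*\<^bsub>with_proj T\<^esub> z"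
  shows "x \<rightarrow>\<^sup>*\<^bsub>with_proj T\<^esub> y \<or> y \<rightarrow>\<^sup>*\<^bsub>with_proj T\<^esub> x"
proof -
  interpret pair_wf_digraph T using T by (simp add: rooted_tree_def)
  obtain s t where s: "awalk x s z" and t: "awalk y t z" using x y by (auto simp: reachable_awalk)
  obtain p where p: "awalk r p x" using rooted_tree_awalk[OF T awalk_hd_in_verts[OF s]] .
  obtain q where q: "awalk r q y" using rooted_tree_awalk[OF T awalk_hd_in_verts[OF t]] .
  have ps: "awalk r (p @ s) z" "awalk r (q @ t) z"
    using awalk_appendI p q s t by blast+
  then have "p @ s = q @ t"
    by (rule rooted_tree_unique_awalk[OF T])
  then obtain u where "p = q @ u \<or> q = p @ u"
    by (auto simp: append_eq_append_conv2)
  then show ?thesis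
  proof
    assume "p = q @ u"
    then have "awalk y u x" using p q by (metis awalk_append_iff awlast_of_awalk awalkE')
    then show ?thesis by (auto simp: reachable_awalk)
  next
    assume "q = p @ u"
    then have "awalk x u y" using p q by (metis awalk_append_iff awlast_of_awalk awalkE')
    then show ?thesis by (auto simp: reachable_awalk)
  qed
qed

text \<open>A cycle at \<open>x\<close> could be appended to the root walk of \<open>x\<close>,
  giving a second walk from the root.\<close>

lemma rooted_tree_no_cycle:
  assumes T: "rooted_tree r T"
  shows "\<not> x \<rightarrow>\<^sup>+\<^bsub>with_proj T\<^esub> x"
proof
  interpret pair_wf_digraph T using T by (simp add: rooted_tree_def)
  assume "x \<rightarrow>\<^sup>+\<^bsub>with_proj T\<^esub> x"
  then obtain s where s: "awalk x s x" "s \<noteq> []" using reachable1_awalk by auto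
  obtain p where p: "awalk r p x" using rooted_tree_awalk[OF T awalk_hd_in_verts[OF s(1)]] .
  have "p @ s = p"
    using rooted_tree_unique_awalk[OF T awalk_appendI[OF p s(1)] p] .
  then show False using s(2) by simp
qed

text \<open>Unlike \<open>leaves\<close>, this includes a root without children, so even a skeleton
  with a single vertex has a branch ending in a tip.\<close>

definition tips :: "'v pair_pre_digraph \<Rightarrow> 'v set" where
  "tips T = {v \<in> pverts T. \<forall>u. (v, u) \<notin> parcs T}"

text \<open>If the root is a tip, it is the only vertex; otherwise all tips are leaves. The maximum
  with 1 is absorbed later by \<open>1 \<le> w\<close>.\<close>

lemma card_tips_le:
  assumes T: "rooted_tree r T" and fin: "finite (pverts T)"
  shows "card (tips T) \<le> max 1 (card (leaves r T))"
proof (cases "r \<in> tips T")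
  case True
  interpret pair_wf_digraph T using T by (simp add: rooted_tree_def)
  have "v = r" if v: "v \<in> pverts T" for v
  proof -
    obtain p where p: "awalk r p v" using rooted_tree_awalk[OF T v] .
    show ?thesis
    proof (cases p)
      case Nil
      then show ?thesis using p by (simp add: awalk_Nil_iff)
    next
      case (Cons e q)
      then have "(r, snd e) \<in> parcs T" using p by (metis awalk_Cons_iff prod.collapse)
      then show ?thesis using True by (simp add: tips_def)
    qed
  qed
  then have "tips T \<subseteq> {r}" by (auto simp: tips_def)
  then have "card (tips T) \<le> card {r}" by (intro card_mono) auto
  then show ?thesis by simp
next
  case False
  then have "tips T \<subseteq> leaves r T" by (auto simp: tips_def leaves_def)
  then have "card (tips T) \<le> card (leaves r T)"
    using fin by (intro card_mono) (auto simp: leaves_def)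
  then show ?thesis by simp
qed

lemma reachable_tip:
  assumes T: "rooted_tree r T" and fin: "finite (pverts T)" and v: "v \<in> pverts T"
  shows "\<exists>t\<in>tips T. v \<rightarrow>\<^sup>*\<^bsub>with_proj T\<^esub> t"
proof -
  interpret pair_wf_digraph T using T by (simp add: rooted_tree_def)
  have "parcs T \<subseteq> pverts T \<times> pverts T" by (auto intro: wellformed')
  then have "finite (parcs T)" using fin by (meson finite_SigmaI finite_subset)
  moreover have "acyclic (parcs T)" using rooted_tree_no_cycle[OF T] by (simp add: acyclic_def)
  ultimately have "wf ((parcs T)\<inverse>)" by (rule finite_acyclic_wf_converse)
  then show ?thesis using v
  proof (induction v)
    case (less v)
    show ?case
    proof (cases "v \<in> tips T")
      case True
      then show ?thesis using less.prems by auto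
    next
      case False
      then obtain u where u: "(v, u) \<in> parcs T" using less.prems by (auto simp: tips_def)
      then obtain t where "t \<in> tips T" "u \<rightarrow>\<^sup>*\<^bsub>with_proj T\<^esub> t"
        using less.IH[of u] wellformed' by auto
      moreover have "v \<rightarrow>\<^sup>*\<^bsub>with_proj T\<^esub> u" using u by auto
      ultimately show ?thesis using reachable_trans by blast
    qed
  qed
qed

section \<open>Depth in a rooted tree\<close>

definition depth :: "('v \<times> 'v) weight_fun \<Rightarrow> 'v \<Rightarrow> 'v pair_pre_digraph \<Rightarrow> 'v \<Rightarrow> real" where
  "depth wt r T v = real_of_ereal (gdist (with_proj T) wt r v)"

text \<open>Exactly one walk leads from the root to \<open>v\<close>, so the distance is an infimum
  over a single cost.\<close>

lemma gdist_root:
  assumes T: "rooted_tree r T" and p: "pre_digraph.awalk (with_proj T) r p v"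
  shows "gdist (with_proj T) wt r v = ereal (wf_digraph.awalk_cost wt p)"
proof -
  interpret pair_wf_digraph T using T by (simp add: rooted_tree_def)
  have "{q. awalk r q v} = {p}"
    using p rooted_tree_unique_awalk[OF T _ p] by blast
  then show ?thesis by (simp add: \<mu>_def)
qed

text \<open>Tree vertices have finite distance from the root, so \<open>real_of_ereal\<close> loses
  nothing in \<open>depth\<close>.\<close>

lemma gdist_root_depth:
  assumes T: "rooted_tree r T" and v: "v \<in> pverts T"
  shows "gdist (with_proj T) wt r v = ereal (depth wt r T v)"
proof -
  obtain p where "pre_digraph.awalk (with_proj T) r p v"
    using rooted_tree_awalk[OF T v] .
  from gdist_root[OF T this] show ?thesis by (simp add: depth_def)
qed

context weighted_graph begin

lemma awalk_subtree_walk_in: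
  assumes "pre_digraph.awalk (with_proj T) u p v" "subgraph (with_proj T) (with_proj G \<restriction> X)"
  shows "walk_in G wt X u v (wf_digraph.awalk_cost wt p)"
  by (rule awalk_walk_in[OF wf_digraph.subgraph_awalk_imp_awalk[OF wellformed_induce_subgraph assms]])

lemma depth_nonneg:
  assumes T: "rooted_tree r T" "subgraph (with_proj T) (with_proj G \<restriction> X)" and v: "v \<in> pverts T"
  shows "0 \<le> depth wt r T v"
proof -
  obtain p where p: "pre_digraph.awalk (with_proj T) r p v"
    using rooted_tree_awalk[OF T(1) v] .
  then show ?thesis
    using gdist_root[OF T(1) p, of wt] walk_in_nonneg awalk_subtree_walk_in[OF p T(2)]
    by (simp add: depth_def)
qed

lemma walk_in_descendant:
  assumes T: "rooted_tree r T" "subgraph (with_proj T) (with_proj G \<restriction> X)"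
    and uv: "u \<rightarrow>\<^sup>*\<^bsub>with_proj T\<^esub> v"
  shows "walk_in G wt X u v (depth wt r T v - depth wt r T u)"
proof -
  interpret T: pair_wf_digraph T using T by (simp add: rooted_tree_def)
  obtain s where s: "T.awalk u s v" using uv by (auto simp: T.reachable_awalk)
  obtain p where p: "T.awalk r p u" using rooted_tree_awalk[OF T(1) T.awalk_hd_in_verts[OF s]] .
  have "T.awalk r (p @ s) v" using T.awalk_appendI p s by blast
  from gdist_root[OF T(1) this, of wt] gdist_root[OF T(1) p, of wt]
  have "depth wt r T v - depth wt r T u = T.awalk_cost wt s" by (simp add: depth_def)
  then show ?thesis using awalk_subtree_walk_in[OF s T(2)] by simp
qed

lemma walk_in_same_branch:
  assumes T: "rooted_tree r T" "subgraph (with_proj T) (with_proj G \<restriction> X)"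
    and "u \<rightarrow>\<^sup>*\<^bsub>with_proj T\<^esub> z" "v \<rightarrow>\<^sup>*\<^bsub>with_proj T\<^esub> z"
  shows "walk_in G wt X u v \<bar>depth wt r T u - depth wt r T v\<bar>"
  using rooted_tree_linear[OF assms(1,3,4)]
proof
  assume "u \<rightarrow>\<^sup>*\<^bsub>with_proj T\<^esub> v"
  note w = walk_in_descendant[OF T this]
  show ?thesis using w walk_in_nonneg[OF w] by simp
next
  assume "v \<rightarrow>\<^sup>*\<^bsub>with_proj T\<^esub> u"
  note w = walk_in_sym[OF walk_in_descendant[OF T this]]
  show ?thesis using w walk_in_nonneg[OF w] by simp
qed

text \<open>In a shortest path tree the depth is the distance from the root in the whole of
  \<open>D\<close>, hence 1-Lipschitz along walks of \<open>D\<close>, including those outside the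
  tree.\<close>

lemma depth_diff_le_walk:
  assumes T: "sssp_tree (with_proj G \<restriction> D) wt r T"
    and uv: "u \<in> pverts T" "v \<in> pverts T" "walk_in G wt D u v c"
  shows "\<bar>depth wt r T u - depth wt r T v\<bar> \<le> c"
proof -
  have tree: "rooted_tree r T" "subgraph (with_proj T) (with_proj G \<restriction> D)"
    using T by (auto simp: sssp_tree_def)
  interpret T: pair_wf_digraph T using tree by (simp add: rooted_tree_def)
  have *: "depth wt r T v \<le> depth wt r T u + c"
    if u: "u \<in> pverts T" and v: "v \<in> pverts T" and w: "walk_in G wt D u v c" for u v
  proof -
    obtain p where p: "T.awalk r p u" using rooted_tree_awalk[OF tree(1) u] .
    have "walk_in G wt D r u (depth wt r T u)"
      using awalk_subtree_walk_in[OF p tree(2)] gdist_root[OF tree(1) p, of wt]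
      by (simp add: depth_def)
    then have "walk_in G wt D r v (depth wt r T u + c)"
      using w walk_in_trans by fast
    from gdist_le_walk[OF this] show ?thesis
      using T v gdist_root_depth[OF tree(1) v, of wt] by (auto simp: sssp_tree_def)
  qed
  show ?thesis using *[OF uv] *[OF uv(2,1) walk_in_sym[OF uv(3)]] by linarith
qed

end

section \<open>Reachability between supernodes\<close>

locale cop_decomposition = weighted_graph G wt for G :: "'a pair_pre_digraph" and wt +
  fixes \<Delta> \<gamma> :: real and w :: nat and \<rho> :: "'a set" and \<T> :: "'a set pair_pre_digraph"
    and rt :: "'a set \<Rightarrow> 'a" and sk :: "'a set \<Rightarrow> 'a pair_pre_digraph"
  assumes decomp: "buffered_cop_decomposition G wt \<Delta> \<gamma> w \<rho> \<T> rt sk"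
begin

section \<open>The ancestor order and the domains\<close>

abbreviation "\<N> \<equiv> pverts \<T>"
abbreviation "Dom \<equiv> dom_verts \<T>"

text \<open>Pairs are oriented from a node to its ancestor, the direction in which walks leave
  domains.\<close>

definition anc :: "('a set \<times> 'a set) set" where
  "anc = {(\<eta>, \<eta>'). strict_ancestor \<T> \<eta>' \<eta>}"

definition adj :: "('a set \<times> 'a set) set" where
  "adj = {(\<eta>, \<eta>'). \<eta> \<in> \<N> \<and> \<eta>' \<in> adj_ancestors G \<T> \<eta>}"

lemma tree: "rooted_tree \<rho> \<T>" and partition: "partition_on (pverts G) \<N>"
  and joined_related: "\<eta> \<in> \<N> \<Longrightarrow> \<eta>' \<in> \<N> \<Longrightarrow> joined G \<eta> \<eta>' \<Longrightarrow> \<eta> = \<eta>' \<or> (\<eta>, \<eta>') \<in> anc \<or> (\<eta>', \<eta>) \<in> anc"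
  using decomp by (auto simp: buffered_cop_decomposition_def partition_tree_def anc_def)

lemma supernodeD: "\<eta> \<in> \<N> \<Longrightarrow> supernode G wt \<Delta> \<eta> (rt \<eta>) (sk \<eta>)"
  and sssp: "\<eta> \<in> \<N> \<Longrightarrow> sssp_tree (with_proj G \<restriction> Dom \<eta>) wt (rt \<eta>) (sk \<eta>)"
  and card_leaves: "\<eta> \<in> \<N> \<Longrightarrow> card (leaves (rt \<eta>) (sk \<eta>)) \<le> w"
  and card_adj_ancestors: "\<eta> \<in> \<N> \<Longrightarrow> card (adj_ancestors G \<T> \<eta>) \<le> w"
  using decomp by (auto simp: buffered_cop_decomposition_def domain_graph_def)

lemma tree_wf: "pair_wf_digraph \<T>"
  using tree by (simp add: rooted_tree_def)

lemma anc_nodes: "(\<eta>, \<eta>') \<in> anc \<Longrightarrow> \<eta> \<in> \<N> \<and> \<eta>' \<in> \<N>"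
proof -
  interpret T: pair_wf_digraph \<T> by (rule tree_wf)
  show "(\<eta>, \<eta>') \<in> anc \<Longrightarrow> ?thesis"
    using T.reachable1_in_verts by (auto simp: anc_def strict_ancestor_def)
qed

lemma reachable_iff_anc:
  "\<eta> \<rightarrow>\<^sup>*\<^bsub>with_proj \<T>\<^esub> \<eta>' \<longleftrightarrow> \<eta> \<in> \<N> \<and> (\<eta>' = \<eta> \<or> (\<eta>', \<eta>) \<in> anc)"
proof -
  interpret T: pair_wf_digraph \<T> by (rule tree_wf)
  show ?thesis
    using T.reachable_in_verts(1)[of \<eta> \<eta>'] T.reachable_neq_reachable1[of \<eta> \<eta>'] T.reachable1_reachable[of \<eta> \<eta>']
    by (auto simp: anc_def strict_ancestor_def)
qed

lemma trans_anc: "trans anc"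
  by (auto simp: anc_def strict_ancestor_def intro!: transI)

lemma irrefl_anc: "irrefl anc"
  using rooted_tree_no_cycle[OF tree] by (auto simp: anc_def strict_ancestor_def irrefl_def)

lemma anc_trans: "(x, y) \<in> anc \<Longrightarrow> (y, z) \<in> anc \<Longrightarrow> (x, z) \<in> anc"
  using trans_anc by (rule transD)

lemma anc_asym: "(x, y) \<in> anc \<Longrightarrow> (y, x) \<notin> anc" "(x, x) \<notin> anc"
  using anc_trans irrefl_anc by (auto simp: irrefl_def)

lemma anc_linear: "(x, a) \<in> anc \<Longrightarrow> (x, b) \<in> anc \<Longrightarrow> a = b \<or> (a, b) \<in> anc \<or> (b, a) \<in> anc"
  using rooted_tree_linear[OF tree, of a x b] anc_nodes unfolding reachable_iff_anc by blast

lemma anc_linear': "x = a \<or> (x, a) \<in> anc \<Longrightarrow> x = b \<or> (x, b) \<in> anc \<Longrightarrow> a = b \<or> (a, b) \<in> anc \<or> (b, a) \<in> anc"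
  using anc_linear by blast

lemma finite_nodes: "finite \<N>"
  using finite_elements[OF pair_finite_verts partition] .

lemma wf_anc: "wf (anc\<inverse>)"
proof (rule finite_acyclic_wf_converse)
  have "anc \<subseteq> \<N> \<times> \<N>" using anc_nodes by auto
  then show "finite anc" using finite_nodes by (meson finite_SigmaI finite_subset)
  show "acyclic anc" using trans_anc irrefl_anc by (simp add: acyclic_irrefl)
qed

lemma node_of:
  assumes "v \<in> pverts G"
  obtains \<eta> where "\<eta> \<in> \<N>" "v \<in> \<eta>"
  using assms partition by (auto simp: partition_on_def)

lemma node_unique: "\<eta> \<in> \<N> \<Longrightarrow> \<eta>' \<in> \<N> \<Longrightarrow> v \<in> \<eta> \<Longrightarrow> v \<in> \<eta>' \<Longrightarrow> \<eta> = \<eta>'"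
  using partition by (auto simp: partition_on_def disjoint_def)

lemma in_dom_iff:
  assumes "\<eta> \<in> \<N>" "\<xi> \<in> \<N>" "v \<in> \<xi>"
  shows "v \<in> Dom \<eta> \<longleftrightarrow> \<xi> = \<eta> \<or> (\<xi>, \<eta>) \<in> anc"
  using assms node_unique anc_nodes unfolding dom_verts_def reachable_iff_anc by blast

lemma in_domE:
  assumes "v \<in> Dom \<eta>" "\<eta> \<in> \<N>"
  obtains \<xi> where "\<xi> \<in> \<N>" "v \<in> \<xi>" "\<xi> = \<eta> \<or> (\<xi>, \<eta>) \<in> anc"
  using assms anc_nodes unfolding dom_verts_def reachable_iff_anc by blast

lemma node_subset: "\<eta> \<in> \<N> \<Longrightarrow> \<eta> \<subseteq> pverts G"
  using partition by (auto simp: partition_on_def)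

lemma dom_subset: "\<eta> \<in> \<N> \<Longrightarrow> Dom \<eta> \<subseteq> pverts G"
  using in_domE node_subset by blast

lemma node_dom: "\<eta> \<in> \<N> \<Longrightarrow> \<eta> \<subseteq> Dom \<eta>"
  using in_dom_iff by blast

lemma dom_mono:
  assumes "(\<eta>, \<eta>') \<in> anc"
  shows "Dom \<eta> \<subseteq> Dom \<eta>'"
proof
  fix v assume v: "v \<in> Dom \<eta>"
  have N: "\<eta> \<in> \<N>" "\<eta>' \<in> \<N>" using assms anc_nodes by auto
  obtain \<xi> where "\<xi> \<in> \<N>" "v \<in> \<xi>" "\<xi> = \<eta> \<or> (\<xi>, \<eta>) \<in> anc" using in_domE[OF v N(1)] .
  then show "v \<in> Dom \<eta>'" using in_dom_iff[OF N(2)] assms anc_trans by blast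
qed

section \<open>Adjacent ancestors and walks leaving a domain\<close>

lemma adj_anc: "(\<eta>, \<eta>') \<in> adj \<Longrightarrow> (\<eta>, \<eta>') \<in> anc"
  by (auto simp: adj_def anc_def adj_ancestors_def)

lemma adj_subset_anc: "adj \<subseteq> anc"
  using adj_anc by (rule subrelI)

lemma adj_iff: "(\<eta>, \<eta>') \<in> adj \<longleftrightarrow> (\<eta>, \<eta>') \<in> anc \<and> joined G (Dom \<eta>) \<eta>'"
  using anc_nodes by (auto simp: adj_def anc_def adj_ancestors_def)

text \<open>An edge from \<open>Dom \<eta>\<close> to \<open>\<xi>\<close> also starts in the larger
  set \<open>Dom \<zeta>\<close>. This is the closure hypothesis of
  \<open>card_reach_upto\<close>.\<close>

lemma adj_closed: "(\<eta>, \<xi>) \<in> adj \<Longrightarrow> (\<eta>, \<zeta>) \<in> anc \<Longrightarrow> (\<zeta>, \<xi>) \<in> anc \<Longrightarrow> (\<zeta>, \<xi>) \<in> adj"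
  using dom_mono unfolding adj_iff joined_def by blast

lemma adj_degree: "finite (adj `` {\<eta>}) \<and> card (adj `` {\<eta>}) \<le> w"
proof (cases "\<eta> \<in> \<N>")
  case True
  have "adj `` {\<eta>} \<subseteq> \<N>" using adj_anc anc_nodes by blast
  moreover have "adj `` {\<eta>} = adj_ancestors G \<T> \<eta>" using True by (auto simp: adj_def)
  ultimately show ?thesis using card_adj_ancestors[OF True] finite_nodes finite_subset by metis
next
  case False
  then have "adj `` {\<eta>} = {}" by (auto simp: adj_def)
  then show ?thesis by simp
qed

text \<open>Edges join only related nodes. The node of \<open>b\<close> is outside the subtree of
  \<open>\<zeta>\<close>, so it is an ancestor of the node of \<open>a\<close>; the ancestors of
  that node form a chain containing \<open>\<zeta>\<close>, which puts it above
  \<open>\<zeta>\<close>.\<close>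

lemma edge_leaving_dom:
  assumes "(a, b) \<in> parcs G" "a \<in> Dom \<zeta>" "b \<notin> Dom \<zeta>" "\<zeta> \<in> \<N>"
  obtains \<xi> where "b \<in> \<xi>" "(\<zeta>, \<xi>) \<in> adj"
proof -
  obtain \<alpha> where \<alpha>: "\<alpha> \<in> \<N>" "a \<in> \<alpha>" "\<alpha> = \<zeta> \<or> (\<alpha>, \<zeta>) \<in> anc" using assms in_domE by blast
  obtain \<beta> where \<beta>: "\<beta> \<in> \<N>" "b \<in> \<beta>" using assms(1) node_of in_arcsD2 by blast
  have nb: "\<not> (\<beta> = \<zeta> \<or> (\<beta>, \<zeta>) \<in> anc)" using in_dom_iff \<beta> assms by blast
  have "joined G \<alpha> \<beta>" using assms(1) \<alpha> \<beta> by (auto simp: joined_def)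
  then have "(\<alpha>, \<beta>) \<in> anc"
    using joined_related[OF \<alpha>(1) \<beta>(1)] nb \<alpha>(3) anc_trans by blast
  then have "(\<zeta>, \<beta>) \<in> anc" using anc_linear' \<alpha>(3) nb by blast
  then show ?thesis using that[of \<beta>] \<beta>(2) assms by (auto simp: adj_iff joined_def)
qed

text \<open>The first part includes the exit arc. It lies in \<open>Dom \<xi>\<close>, because
  \<open>Dom \<zeta>\<close> does and its endpoint is in \<open>\<xi>\<close>; so the buffer
  property can be applied to its length.\<close>

lemma walk_leaving_dom:
  assumes "walk_in G wt X z y c" "z \<in> Dom \<zeta>" "y \<notin> Dom \<zeta>" "\<zeta> \<in> \<N>" "Dom \<zeta> \<subseteq> X"
  obtains \<xi> b c1 c2 where "(\<zeta>, \<xi>) \<in> adj" "b \<in> \<xi>" "b \<in> X" "walk_in G wt (Dom \<xi>) z b c1"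
    "walk_in G wt X b y c2" "c = c1 + c2"
proof -
  have "\<not> walk_in G wt (X \<inter> Dom \<zeta>) z y c" using assms(3) walk_in_ends by fast
  then obtain a b c1 c2 where *: "walk_in G wt (X \<inter> Dom \<zeta>) z a c1" "(a, b) \<in> parcs G"
    "b \<in> X - Dom \<zeta>" "walk_in G wt X b y c2" "c = c1 + wt (a, b) + c2"
    using walk_in_exit[OF assms(1,2)] by blast
  have a: "a \<in> Dom \<zeta>" using *(1) walk_in_ends by fast
  obtain \<xi> where \<xi>: "b \<in> \<xi>" "(\<zeta>, \<xi>) \<in> adj" using edge_leaving_dom[OF *(2) a] *(3) assms(4) by blast
  have "Dom \<zeta> \<subseteq> Dom \<xi>" "b \<in> Dom \<xi>"
    using dom_mono adj_anc \<xi> node_dom anc_nodes by blast+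
  then have "walk_in G wt (Dom \<xi>) z b (c1 + wt (a, b))"
    using walk_in_mono[OF *(1)] *(2) by (intro walk_in.step) auto
  then show ?thesis using that \<xi> * by blast
qed

text \<open>
  The walk is cut at the topmost \<open>\<zeta> \<in> adj `` {\<eta>}\<close> below \<open>\<eta>'\<close>. It leaves \<open>Dom \<zeta>\<close> at some \<open>\<xi>\<close> that
  is not adjacent to \<open>\<eta>\<close>, so by the buffer property these two steps cost more than \<open>\<gamma>\<close>.
\<close>

lemma short_walk_reach:
  assumes "0 < \<gamma>"
  shows "\<lbrakk>(\<eta>, \<eta>') \<in> anc; walk_in G wt (Dom \<eta>') z y c; z \<in> Dom \<eta>; y \<in> \<eta>'; c \<le> real k * \<gamma>; 1 \<le> k\<rbrakk>
    \<Longrightarrow> \<eta>' \<in> reach_upto adj (2 * k - 1) \<eta>"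
proof (induction k arbitrary: \<eta> z c)
  case 0
  then show ?case by simp
next
  case (Suc k)
  note prems = Suc.prems
  have N: "\<eta> \<in> \<N>" "\<eta>' \<in> \<N>" using anc_nodes prems(1) by auto
  have outside: "y \<notin> Dom \<zeta>" if "(\<zeta>, \<eta>') \<in> anc" for \<zeta>
    using that in_dom_iff[OF _ N(2) prems(4)] anc_nodes anc_asym by blast
  have below: "\<xi> = \<eta>' \<or> (\<xi>, \<eta>') \<in> anc" if "b \<in> \<xi>" "\<xi> \<in> \<N>" "b \<in> Dom \<eta>'" for b \<xi>
    using that in_dom_iff N by blast
  define A where "A = {\<xi> \<in> adj `` {\<eta>}. \<xi> = \<eta>' \<or> (\<xi>, \<eta>') \<in> anc}"
  obtain \<xi>\<^sub>0 b\<^sub>0 where "(\<eta>, \<xi>\<^sub>0) \<in> adj" "b\<^sub>0 \<in> \<xi>\<^sub>0" "b\<^sub>0 \<in> Dom \<eta>'"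
    using walk_leaving_dom[OF prems(2,3) outside[OF prems(1)] N(1) dom_mono[OF prems(1)]] by metis
  then have "\<xi>\<^sub>0 \<in> A" using below anc_nodes adj_anc unfolding A_def by blast
  then have "A \<noteq> {}" by blast
  moreover have "finite A" using adj_degree[of \<eta>] finite_subset[of A "adj `` {\<eta>}"] unfolding A_def by blast
  moreover have "a = b \<or> (a, b) \<in> anc \<or> (b, a) \<in> anc" if "a \<in> A" "b \<in> A" for a b
    using that adj_anc anc_linear unfolding A_def by blast
  ultimately obtain \<zeta> where \<zeta>: "\<zeta> \<in> A" "\<And>a. a \<in> A \<Longrightarrow> a \<noteq> \<zeta> \<Longrightarrow> (a, \<zeta>) \<in> anc"
    using finite_linear_top[OF _ _ trans_anc irrefl_anc, of A] by blast
  have \<zeta>': "(\<eta>, \<zeta>) \<in> adj" using \<zeta>(1) unfolding A_def by blast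
  show ?case
  proof (cases "\<zeta> = \<eta>'")
    case True
    then show ?thesis using \<zeta>' by (auto simp: reach_upto_def intro!: exI[of _ "1 :: nat"])
  next
    case False
    then have \<zeta>\<eta>': "(\<zeta>, \<eta>') \<in> anc" using \<zeta>(1) unfolding A_def by blast
    then have \<zeta>N: "\<zeta> \<in> \<N>" using anc_nodes by blast
    have z: "z \<in> Dom \<zeta>" using dom_mono[OF adj_anc[OF \<zeta>']] prems(3) by blast
    obtain \<xi> b c1 c2 where \<xi>: "(\<zeta>, \<xi>) \<in> adj" "b \<in> \<xi>" "b \<in> Dom \<eta>'" "walk_in G wt (Dom \<xi>) z b c1"
      "walk_in G wt (Dom \<eta>') b y c2" "c = c1 + c2"
      using walk_leaving_dom[OF prems(2) z outside[OF \<zeta>\<eta>'] \<zeta>N dom_mono[OF \<zeta>\<eta>']] by metis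
    have \<xi>N: "\<xi> \<in> \<N>" using \<xi>(1) adj_anc anc_nodes by blast
    have b: "\<xi> = \<eta>' \<or> (\<xi>, \<eta>') \<in> anc" using below[OF \<xi>(2) \<xi>N \<xi>(3)] .
    have \<eta>\<xi>: "(\<eta>, \<xi>) \<in> anc" using adj_anc[OF \<xi>(1)] adj_anc[OF \<zeta>'] anc_trans by blast
    have "(\<eta>, \<xi>) \<notin> adj"
    proof
      assume "(\<eta>, \<xi>) \<in> adj"
      then have "\<xi> \<in> A" using b unfolding A_def by blast
      then show False using \<zeta>(2)[of \<xi>] adj_anc[OF \<xi>(1)] anc_asym by blast
    qed
    \<comment> \<open>Since \<open>\<eta>\<close> lies in its own domain, an edge between
      \<open>\<eta>\<close> and \<open>\<xi>\<close> would put the pair in \<open>adj\<close>. Only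
      the distance alternative of the buffer property remains.\<close>
    then have "\<not> joined G \<eta> \<xi>"
      using \<eta>\<xi> node_dom[OF N(1)] unfolding adj_iff joined_def by blast
    then have "ereal \<gamma> < gdist_set (with_proj G \<restriction> Dom \<xi>) wt z \<xi>"
      using decomp N(1) \<xi>N \<eta>\<xi> prems(3)
      unfolding buffered_cop_decomposition_def domain_graph_def anc_def by blast
    then have "ereal \<gamma> < ereal c1"
      using gdist_set_le_walk[OF \<xi>(4,2)] by (rule less_le_trans)
    then have c1: "\<gamma> < c1" by simp
    have "0 \<le> c2" using \<xi>(5) walk_in_nonneg by blast
    \<comment> \<open>Less than \<open>real k * \<gamma>\<close> is left after paying
      \<open>c1\<close>. As \<open>c2\<close> is nonnegative, this also rules out
      \<open>k = 0\<close>, so the induction hypothesis applies.\<close>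
    then have c2: "c2 \<le> real k * \<gamma>" "0 < real k * \<gamma>"
      using c1 prems(5) \<xi>(6) by (simp_all add: algebra_simps)
    then have k: "1 \<le> k" by (cases k) auto
    have two: "(\<eta>, \<xi>) \<in> adj ^^ 2" using \<zeta>' \<xi>(1) by (auto simp: numeral_2_eq_2)
    show ?thesis
    proof (cases "\<xi> = \<eta>'")
      case True
      moreover have "2 \<le> 2 * Suc k - 1" using k by simp
      ultimately show ?thesis using two unfolding reach_upto_def by blast
    next
      case False
      then have \<xi>\<eta>': "(\<xi>, \<eta>') \<in> anc" using b by blast
      have "b \<in> Dom \<xi>" using node_dom[OF \<xi>N] \<xi>(2) by blast
      from Suc.IH[OF \<xi>\<eta>' \<xi>(5) this prems(4) c2(1) k]
      obtain i where i: "i \<le> 2 * k - 1" "(\<xi>, \<eta>') \<in> adj ^^ i" unfolding reach_upto_def by blast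
      \<comment> \<open>Each unit \<open>\<gamma>\<close> of length pays for two steps: 2 + (2 k -
        1) = 2 (k + 1) - 1.\<close>
      have "(\<eta>, \<eta>') \<in> adj ^^ (2 + i)" using two i(2) unfolding relpow_add by blast
      moreover have "2 + i \<le> 2 * Suc k - 1" using i(1) k by simp
      ultimately show ?thesis unfolding reach_upto_def by blast
    qed
  qed
qed

lemma colouring:
  assumes "1 \<le> q"
  obtains col where "\<And>\<eta>. col \<eta> < (w + 2 * q - 1) choose w"
    "\<And>\<eta> \<eta>'. \<eta>' \<in> reach_upto adj (2 * q - 1) \<eta> \<Longrightarrow> \<eta>' \<noteq> \<eta> \<Longrightarrow> col \<eta>' \<noteq> (col \<eta> :: nat)"
proof -
  define N where "N \<eta> = reach_upto adj (2 * q - 1) \<eta> - {\<eta>}" for \<eta>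
  have r: "finite (reach_upto adj (2 * q - 1) \<eta>) \<and>
    card (reach_upto adj (2 * q - 1) \<eta>) \<le> (w + (2 * q - 1)) choose w" for \<eta>
  proof (rule card_reach_upto[OF trans_anc irrefl_anc])
    show "a = b \<or> (a, b) \<in> anc \<or> (b, a) \<in> anc" if "(x, a) \<in> anc" "(x, b) \<in> anc" for x a b
      using that by (rule anc_linear)
    show "(b, a) \<in> adj" if "(x, a) \<in> adj" "(x, b) \<in> anc" "(b, a) \<in> anc" for x a b
      using that by (rule adj_closed)
  qed (rule adj_subset_anc adj_degree)+
  have "\<exists>f. \<forall>\<eta>. f \<eta> < (w + (2 * q - 1)) choose w \<and> (\<forall>\<eta>'\<in>N \<eta>. f \<eta>' \<noteq> f \<eta>)"
  proof (rule greedy_colouring[OF wf_anc])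
    fix \<eta>
    show "finite (N \<eta>)" using r by (simp add: N_def)
    \<comment> \<open>\<open>\<eta>\<close> reaches itself in zero steps, so deleting it makes the
      bound strict, as greedy colouring needs.\<close>
    have "\<eta> \<in> reach_upto adj (2 * q - 1) \<eta>" by (auto simp: reach_upto_def intro: exI[of _ 0])
    then have "card (N \<eta>) < card (reach_upto adj (2 * q - 1) \<eta>)"
      unfolding N_def using r by (intro card_Diff1_less) auto
    then show "card (N \<eta>) < (w + (2 * q - 1)) choose w" using r[of \<eta>] by linarith
  next
    fix \<eta> \<eta>' assume "\<eta>' \<in> N \<eta>"
    then have "\<eta>' \<noteq> \<eta>" "(\<eta>, \<eta>') \<in> adj\<^sup>*"
      by (auto simp: N_def reach_upto_def intro: relpow_imp_rtrancl)
    then have "(\<eta>, \<eta>') \<in> adj\<^sup>+" by (simp add: rtrancl_eq_or_trancl)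
    then have "(\<eta>, \<eta>') \<in> anc\<^sup>+" using adj_subset_anc by (rule trancl_mono)
    then show "(\<eta>', \<eta>) \<in> anc\<inverse>" by (simp add: trancl_id[OF trans_anc])
  qed
  moreover have "w + (2 * q - 1) = w + 2 * q - 1" using assms by simp
  ultimately show ?thesis using that unfolding N_def by (metis DiffI singletonD)
qed

section \<open>Neighbourhoods of supernodes\<close>

definition nbhd :: "real \<Rightarrow> 'a set \<Rightarrow> 'a set" where
  "nbhd r \<eta> = {u. \<exists>x\<in>\<eta>. \<exists>d\<le>r. walk_in G wt (Dom \<eta>) x u d}"

lemma nbhd_subset_dom: "nbhd r \<eta> \<subseteq> Dom \<eta>"
proof
  fix u assume "u \<in> nbhd r \<eta>"
  then obtain x d where "walk_in G wt (Dom \<eta>) x u d" unfolding nbhd_def by blast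
  then show "u \<in> Dom \<eta>" by (rule walk_in_ends[THEN conjunct2])
qed

lemma node_subset_nbhd: "\<eta> \<in> \<N> \<Longrightarrow> 0 \<le> r \<Longrightarrow> \<eta> \<subseteq> nbhd r \<eta>"
proof
  fix u assume "\<eta> \<in> \<N>" "0 \<le> r" and u: "u \<in> \<eta>"
  then have "walk_in G wt (Dom \<eta>) u u 0" using node_dom by (blast intro: walk_in.refl)
  then show "u \<in> nbhd r \<eta>" using u \<open>0 \<le> r\<close> unfolding nbhd_def by blast
qed

text \<open>The node containing \<open>u\<close> lies below both \<open>\<eta>\<close> and
  \<open>\<eta>'\<close>, so these are comparable. From \<open>u\<close>, in the domain of the lower
  one, a walk of length at most \<open>real q * \<gamma>\<close> leads to the upper one inside the
  upper domain, and \<open>short_walk_reach\<close> applies.\<close>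

lemma nbhds_meet:
  assumes "\<eta> \<in> \<N>" "\<eta>' \<in> \<N>" "u \<in> nbhd (real q * \<gamma>) \<eta>" "u \<in> nbhd (real q * \<gamma>) \<eta>'"
    and "0 < \<gamma>" "1 \<le> q"
  shows "\<eta>' \<in> reach_upto adj (2 * q - 1) \<eta> \<or> \<eta> \<in> reach_upto adj (2 * q - 1) \<eta>'"
proof -
  have *: "\<eta>' \<in> reach_upto adj (2 * q - 1) \<eta>"
    if "(\<eta>, \<eta>') \<in> anc" "u \<in> nbhd (real q * \<gamma>) \<eta>" "u \<in> nbhd (real q * \<gamma>) \<eta>'" for \<eta> \<eta>'
  proof -
    obtain x d where x: "x \<in> \<eta>'" "d \<le> real q * \<gamma>" "walk_in G wt (Dom \<eta>') x u d"
      using \<open>u \<in> nbhd (real q * \<gamma>) \<eta>'\<close> unfolding nbhd_def by blast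
    have "u \<in> Dom \<eta>" using that(2) nbhd_subset_dom by blast
    then show ?thesis
      using short_walk_reach[OF \<open>0 < \<gamma>\<close> that(1) walk_in_sym[OF x(3)] _ x(1,2) \<open>1 \<le> q\<close>] by blast
  qed
  obtain \<xi> where "u \<in> \<xi>" "\<xi> \<in> \<N>" "\<xi> = \<eta> \<or> (\<xi>, \<eta>) \<in> anc"
    using in_domE[OF subsetD[OF nbhd_subset_dom assms(3)] assms(1)] by metis
  moreover from this have "\<xi> = \<eta>' \<or> (\<xi>, \<eta>') \<in> anc"
    using in_dom_iff[OF assms(2) _ _, of \<xi> u] subsetD[OF nbhd_subset_dom assms(4)] by blast
  ultimately consider "\<eta> = \<eta>'" | "(\<eta>, \<eta>') \<in> anc" | "(\<eta>', \<eta>) \<in> anc"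
    using anc_linear' by metis
  then show ?thesis
  proof cases
    case 1
    then show ?thesis by (auto simp: reach_upto_def intro: exI[of _ 0])
  qed (use * assms(3,4) in metis)+
qed

lemma ball_in_nbhd:
  assumes v: "v \<in> pverts G" and r: "0 \<le> r"
  obtains \<eta> x where "\<eta> \<in> \<N>" "x \<in> \<eta>"
    "\<And>u. u \<in> gball (with_proj G) wt v r \<Longrightarrow> \<exists>d\<le>2 * r. walk_in G wt (nbhd (2 * r) \<eta>) x u d"
proof -
  define B where "B = gball (with_proj G) wt v r"
  have B: "B = {u. \<exists>d\<le>r. walk_in G wt (pverts G) v u d}" by (simp add: B_def gball_eq)
  have vB: "v \<in> B" using r walk_in.refl[OF v, of G wt] unfolding B by blast
  obtain \<eta>\<^sub>0 where \<eta>\<^sub>0: "\<eta>\<^sub>0 \<in> \<N>" "v \<in> \<eta>\<^sub>0" using node_of[OF v] .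
  \<comment> \<open>Only ancestors of the node of \<open>v\<close> and that node itself are
    considered, which makes \<open>A\<close> a chain with a topmost element.\<close>
  define A where "A = {\<eta> \<in> \<N>. (\<eta>\<^sub>0 = \<eta> \<or> (\<eta>\<^sub>0, \<eta>) \<in> anc) \<and> \<eta> \<inter> B \<noteq> {}}"
  have "finite A" using finite_nodes unfolding A_def by simp
  moreover have "\<eta>\<^sub>0 \<in> A" using \<eta>\<^sub>0 vB unfolding A_def by blast
  then have "A \<noteq> {}" by blast
  moreover have "a = b \<or> (a, b) \<in> anc \<or> (b, a) \<in> anc" if "a \<in> A" "b \<in> A" for a b
    using that anc_linear'[of \<eta>\<^sub>0 a b] unfolding A_def by blast
  ultimately obtain \<eta> where \<eta>: "\<eta> \<in> A" "\<And>a. a \<in> A \<Longrightarrow> a \<noteq> \<eta> \<Longrightarrow> (a, \<eta>) \<in> anc"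
    using finite_linear_top[OF _ _ trans_anc irrefl_anc, of A] by blast
  have \<eta>N: "\<eta> \<in> \<N>" and \<eta>\<^sub>0\<eta>: "\<eta>\<^sub>0 = \<eta> \<or> (\<eta>\<^sub>0, \<eta>) \<in> anc" using \<eta>(1) unfolding A_def by blast+
  obtain x where x: "x \<in> \<eta>" "x \<in> B" using \<eta>(1) unfolding A_def by blast
  have vD: "v \<in> Dom \<eta>" using in_dom_iff[OF \<eta>N \<eta>\<^sub>0] \<eta>\<^sub>0\<eta> by blast
  have inside: "\<exists>d\<le>r. walk_in G wt (Dom \<eta>) v u d" if u: "u \<in> B" for u
  proof -
    obtain d where d: "d \<le> r" "walk_in G wt (pverts G) v u d" using u unfolding B by blast
    have w: "walk_in G wt B v u d" using walk_in_ball[OF d(2,1)] unfolding B .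
    \<comment> \<open>An arc of this kind would enter an ancestor of \<open>\<eta>\<close> that
      meets the ball, contrary to the choice of \<open>\<eta>\<close> as topmost. Hence walks inside
      the ball never leave \<open>Dom \<eta>\<close>.\<close>
    have "\<not> (\<exists>a b. (a, b) \<in> parcs G \<and> a \<in> Dom \<eta> \<and> b \<in> B - Dom \<eta>)"
    proof
      assume "\<exists>a b. (a, b) \<in> parcs G \<and> a \<in> Dom \<eta> \<and> b \<in> B - Dom \<eta>"
      then obtain a b where ab: "(a, b) \<in> parcs G" "a \<in> Dom \<eta>" "b \<in> B" "b \<notin> Dom \<eta>" by blast
      obtain \<xi> where \<xi>: "b \<in> \<xi>" "(\<eta>, \<xi>) \<in> adj" using edge_leaving_dom[OF ab(1,2,4) \<eta>N] .
      have a: "(\<eta>, \<xi>) \<in> anc" using adj_anc[OF \<xi>(2)] .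
      then have "(\<eta>\<^sub>0, \<xi>) \<in> anc" using \<eta>\<^sub>0\<eta> anc_trans by blast
      then have "\<xi> \<in> A" using \<xi>(1) ab(3) anc_nodes[OF a] unfolding A_def by blast
      then show False using \<eta>(2) a anc_asym by blast
    qed
    then have "walk_in G wt (B \<inter> Dom \<eta>) v u d"
      using walk_in_exit[OF w vD] walk_in_ends by (metis IntD2)
    then have "walk_in G wt (Dom \<eta>) v u d" by (rule walk_in_mono) simp
    then show ?thesis using d(1) by blast
  qed
  have "\<exists>d\<le>2 * r. walk_in G wt (nbhd (2 * r) \<eta>) x u d" if u: "u \<in> B" for u
  proof -
    obtain d e where "d \<le> r" "walk_in G wt (Dom \<eta>) v x d" "e \<le> r" "walk_in G wt (Dom \<eta>) v u e"
      using inside[OF x(2)] inside[OF u] by blast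
    then have w: "walk_in G wt (Dom \<eta>) x u (d + e)" and le: "d + e \<le> 2 * r"
      using walk_in_trans[OF walk_in_sym] by auto
    \<comment> \<open>The walk goes from \<open>x\<close> to \<open>v\<close> and on to
      \<open>u\<close>. Each of its vertices is within \<open>2 * r\<close> of \<open>x\<close> in
      the domain, so it stays in the neighbourhood of \<open>\<eta>\<close>.\<close>
    have "{z. \<exists>d\<le>2 * r. walk_in G wt (Dom \<eta>) x z d} \<subseteq> nbhd (2 * r) \<eta>"
      using x(1) unfolding nbhd_def by blast
    then have "walk_in G wt (nbhd (2 * r) \<eta>) x u (d + e)"
      by (rule walk_in_mono[OF walk_in_ball[OF w le]])
    then show ?thesis using le by blast
  qed
  then show ?thesis using that[OF \<eta>N x(1)] unfolding B_def by blast
qed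

end

section \<open>Clusters\<close>

lemma partition_on_add_singletons:
  assumes "disjoint F" "\<And>C. C \<in> F \<Longrightarrow> C \<noteq> {} \<and> C \<subseteq> V"
  shows "partition_on V (F \<union> (\<lambda>v. {v}) ` (V - \<Union>F))"
  unfolding partition_on_def
proof (intro conjI)
  show "\<Union>(F \<union> (\<lambda>v. {v}) ` (V - \<Union>F)) = V" using assms(2) by auto
  show "disjoint (F \<union> (\<lambda>v. {v}) ` (V - \<Union>F))" using assms(1) by (auto simp: disjoint_def)
  show "{} \<notin> F \<union> (\<lambda>v. {v}) ` (V - \<Union>F)" using assms(2) by auto
qed

text \<open>Repetition pads an enumeration to the exact length \<open>n\<close>. This serves to
  index the tips of every skeleton by \<open>{..<w}\<close> and to produce exactly the required
  number of partitions.\<close>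

lemma surj_lessThan_card_le:
  assumes "finite A" "A \<noteq> {}" "card A \<le> n"
  shows "\<exists>f. f ` {..<n :: nat} = A"
proof -
  obtain xs where xs: "set xs = A" "length xs = card A"
    using finite_distinct_list[OF assms(1)] distinct_card by metis
  define ys where "ys = xs @ replicate (n - card A) (hd xs)"
  have "set ys = A" using xs assms(2) by (auto simp: ys_def)
  moreover have "length ys = n" using xs assms(3) by (simp add: ys_def)
  ultimately have "(!) ys ` {..<n} = A" by (auto simp: set_conv_nth)
  then show ?thesis by blast
qed

context cop_decomposition begin

definition level_set :: "'a set \<Rightarrow> 'a \<Rightarrow> nat \<Rightarrow> 'a set" where
  "level_set \<eta> z k = {t \<in> pverts (sk \<eta>). t \<rightarrow>\<^sup>*\<^bsub>with_proj (sk \<eta>)\<^esub> z \<and>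
     nat \<lfloor>depth wt (rt \<eta>) (sk \<eta>) t / \<Delta>\<rfloor> = k}"

text \<open>The choice is arbitrary on an empty level set; only clusters with nonempty level sets
  enter the partitions.\<close>

definition net_point :: "'a set \<Rightarrow> 'a \<Rightarrow> nat \<Rightarrow> 'a" where
  "net_point \<eta> z k = (SOME t. t \<in> level_set \<eta> z k)"

text \<open>Walks are confined to the neighbourhood, not merely to the domain, so that clusters of
  different nodes are disjoint as soon as the neighbourhoods are.\<close>

definition cluster :: "real \<Rightarrow> 'a set \<Rightarrow> 'a \<Rightarrow> nat \<Rightarrow> 'a set" where
  "cluster r \<eta> z k = {u. \<exists>d\<le>2 * \<Delta> + r. walk_in G wt (nbhd r \<eta>) (net_point \<eta> z k) u d}"

lemma skeleton:
  assumes "\<eta> \<in> \<N>"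
  shows "rooted_tree (rt \<eta>) (sk \<eta>)" "subgraph (with_proj (sk \<eta>)) (with_proj G \<restriction> \<eta>)"
    "pverts (sk \<eta>) \<subseteq> \<eta>" "finite (pverts (sk \<eta>))" "pverts (sk \<eta>) \<noteq> {}"
proof -
  show t: "rooted_tree (rt \<eta>) (sk \<eta>)" and s: "subgraph (with_proj (sk \<eta>)) (with_proj G \<restriction> \<eta>)"
    using supernodeD[OF assms] by (simp_all add: supernode_def)
  show v: "pverts (sk \<eta>) \<subseteq> \<eta>" using s by (auto simp: subgraph_def)
  show "finite (pverts (sk \<eta>))"
    using v node_subset[OF assms] pair_finite_verts by (meson finite_subset)
  show "pverts (sk \<eta>) \<noteq> {}" using t by (auto simp: rooted_tree_def)
qed

lemma level_bounds:
  assumes "\<eta> \<in> \<N>" "0 < \<Delta>" "t \<in> level_set \<eta> z k"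
  shows "real k * \<Delta> \<le> depth wt (rt \<eta>) (sk \<eta>) t" "depth wt (rt \<eta>) (sk \<eta>) t < (real k + 1) * \<Delta>"
proof -
  define x where "x = depth wt (rt \<eta>) (sk \<eta>) t / \<Delta>"
  have "0 \<le> x"
    using depth_nonneg[OF skeleton(1,2)[OF assms(1)]] assms(2,3) unfolding x_def level_set_def by simp
  moreover have "nat \<lfloor>x\<rfloor> = k" using assms(3) unfolding x_def level_set_def by simp
  ultimately have "real k \<le> x" "x < real k + 1" by linarith+
  then show "real k * \<Delta> \<le> depth wt (rt \<eta>) (sk \<eta>) t" "depth wt (rt \<eta>) (sk \<eta>) t < (real k + 1) * \<Delta>"
    using assms(2) unfolding x_def by (simp_all add: field_simps)
qed

lemma net_point: "level_set \<eta> z k \<noteq> {} \<Longrightarrow> net_point \<eta> z k \<in> level_set \<eta> z k"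
  unfolding net_point_def by (simp add: some_in_eq)

lemma cluster_subset: "cluster r \<eta> z k \<subseteq> nbhd r \<eta>"
proof
  fix u assume "u \<in> cluster r \<eta> z k"
  then obtain d where "walk_in G wt (nbhd r \<eta>) (net_point \<eta> z k) u d" unfolding cluster_def by blast
  then show "u \<in> nbhd r \<eta>" by (rule walk_in_ends[THEN conjunct2])
qed

lemma cluster_nonempty:
  assumes "\<eta> \<in> \<N>" "0 \<le> r" "0 < \<Delta>" "level_set \<eta> z k \<noteq> {}"
  shows "cluster r \<eta> z k \<noteq> {}"
proof -
  have "net_point \<eta> z k \<in> \<eta>"
    using net_point[OF assms(4)] skeleton(3)[OF assms(1)] unfolding level_set_def by blast
  then have "net_point \<eta> z k \<in> nbhd r \<eta>" using node_subset_nbhd[OF assms(1,2)] by blast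
  then have "walk_in G wt (nbhd r \<eta>) (net_point \<eta> z k) (net_point \<eta> z k) 0" by (rule walk_in.refl)
  moreover have "0 \<le> 2 * \<Delta> + r" using assms(2,3) by simp
  ultimately show ?thesis unfolding cluster_def by blast
qed

lemma cluster_diameter:
  assumes "\<eta> \<in> \<N>"
  shows "strong_diameter G wt (cluster r \<eta> z k) \<le> ereal (2 * (2 * \<Delta> + r))"
  by (rule strong_diameter_ball[OF subset_trans[OF nbhd_subset_dom dom_subset[OF assms]] cluster_def])

text \<open>
  The radius \<open>2 \<Delta> + r\<close> is made up of \<open>\<Delta>\<close> from the net point to the skeleton vertex \<open>t\<close>, \<open>\<Delta>\<close> from \<open>t\<close> to
  \<open>x\<close>, and \<open>r\<close> from \<open>x\<close> to any vertex of the ball.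
\<close>

lemma ball_in_cluster:
  assumes v: "v \<in> pverts G" and r: "0 \<le> r" and \<Delta>: "0 < \<Delta>"
  obtains \<eta> z k where "\<eta> \<in> \<N>" "z \<in> tips (sk \<eta>)" "level_set \<eta> z k \<noteq> {}"
    "gball (with_proj G) wt v (r / 2) \<subseteq> cluster r \<eta> z k"
proof -
  have r2: "0 \<le> r / 2" using r by simp
  have r2': "2 * (r / 2) = r" by simp
  obtain \<eta> x where \<eta>: "\<eta> \<in> \<N>" and x: "x \<in> \<eta>"
    and ball: "\<And>u. u \<in> gball (with_proj G) wt v (r / 2) \<Longrightarrow> \<exists>d\<le>r. walk_in G wt (nbhd r \<eta>) x u d"
    using ball_in_nbhd[OF v r2] unfolding r2' by blast
  note sk = skeleton[OF \<eta>]
  have "gdist_set (with_proj G \<restriction> \<eta>) wt x (pverts (sk \<eta>)) \<le> ereal \<Delta>"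
    using supernodeD[OF \<eta>] x unfolding supernode_def by blast
  then obtain t d where t: "t \<in> pverts (sk \<eta>)" "d \<le> \<Delta>" "walk_in G wt \<eta> x t d"
    using gdist_set_le_imp_walk[OF _ node_subset[OF \<eta>] sk(4,5)] by blast
  obtain z where z: "z \<in> tips (sk \<eta>)" "t \<rightarrow>\<^sup>*\<^bsub>with_proj (sk \<eta>)\<^esub> z"
    using reachable_tip[OF sk(1,4) t(1)] by blast
  define k where "k = nat \<lfloor>depth wt (rt \<eta>) (sk \<eta>) t / \<Delta>\<rfloor>"
  have tk: "t \<in> level_set \<eta> z k" using t(1) z(2) unfolding level_set_def k_def by simp
  then have ne: "level_set \<eta> z k \<noteq> {}" by blast
  define s where "s = net_point \<eta> z k"
  have sk': "s \<in> level_set \<eta> z k" using net_point[OF ne] unfolding s_def .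
  define e where "e = \<bar>depth wt (rt \<eta>) (sk \<eta>) s - depth wt (rt \<eta>) (sk \<eta>) t\<bar>"
  have st: "walk_in G wt \<eta> s t e"
    using walk_in_same_branch[OF sk(1,2) _ z(2)] sk' unfolding level_set_def e_def by blast
  have e: "e \<le> \<Delta>"
    using level_bounds[OF \<eta> \<Delta> tk] level_bounds[OF \<eta> \<Delta> sk'] unfolding e_def by (simp add: algebra_simps abs_le_iff)
  have "walk_in G wt \<eta> s x (e + d)" using walk_in_trans[OF st walk_in_sym[OF t(3)]] .
  then have sx: "walk_in G wt (nbhd r \<eta>) s x (e + d)"
    using node_subset_nbhd[OF \<eta> r] by (rule walk_in_mono)
  have "gball (with_proj G) wt v (r / 2) \<subseteq> cluster r \<eta> z k"
  proof
    fix u assume "u \<in> gball (with_proj G) wt v (r / 2)"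
    then obtain c where c: "c \<le> r" "walk_in G wt (nbhd r \<eta>) x u c" using ball by blast
    have "walk_in G wt (nbhd r \<eta>) s u (e + d + c)" using walk_in_trans[OF sx c(2)] .
    moreover have "e + d + c \<le> 2 * \<Delta> + r" using e t(2) c(1) by simp
    ultimately show "u \<in> cluster r \<eta> z k" unfolding cluster_def s_def by blast
  qed
  then show ?thesis using that[OF \<eta> z(1) ne] by blast
qed

text \<open>A common vertex would give a walk in \<open>Dom \<eta>\<close> between the two net
  points, no longer than two cluster radii. Their depths differ by more than
  \<open>(real M - 1) * \<Delta>\<close>; one level is lost because \<open>s\<close> may lie near
  the upper end of its interval.\<close>

lemma clusters_same_node_disjoint:
  assumes \<eta>: "\<eta> \<in> \<N>" and \<Delta>: "0 < \<Delta>"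
    and ne: "level_set \<eta> z k \<noteq> {}" "level_set \<eta> z k' \<noteq> {}"
    and k: "k + M \<le> k'" and M: "2 * (2 * \<Delta> + r) \<le> (real M - 1) * \<Delta>"
  shows "cluster r \<eta> z k \<inter> cluster r \<eta> z k' = {}"
proof (rule ccontr)
  define s t where "s = net_point \<eta> z k" and "t = net_point \<eta> z k'"
  have s: "s \<in> level_set \<eta> z k" and t: "t \<in> level_set \<eta> z k'"
    using net_point ne unfolding s_def t_def by blast+
  assume "cluster r \<eta> z k \<inter> cluster r \<eta> z k' \<noteq> {}"
  then obtain u c d where *: "c \<le> 2 * \<Delta> + r" "walk_in G wt (nbhd r \<eta>) s u c"
    "d \<le> 2 * \<Delta> + r" "walk_in G wt (nbhd r \<eta>) t u d"
    unfolding cluster_def s_def t_def by blast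
  have "walk_in G wt (Dom \<eta>) s t (c + d)"
    using walk_in_mono[OF walk_in_trans[OF *(2) walk_in_sym[OF *(4)]] nbhd_subset_dom] .
  then have "\<bar>depth wt (rt \<eta>) (sk \<eta>) s - depth wt (rt \<eta>) (sk \<eta>) t\<bar> \<le> c + d"
    using depth_diff_le_walk[OF sssp[OF \<eta>]] s t unfolding level_set_def by blast
  moreover have "(real k + 1) * \<Delta> + (real M - 1) * \<Delta> \<le> real k' * \<Delta>"
    using k \<Delta> by (simp add: distrib_right[symmetric])
  moreover have "c + d \<le> (real M - 1) * \<Delta>" using *(1,3) M by simp
  ultimately show False
    using level_bounds(2)[OF \<eta> \<Delta> s] level_bounds(1)[OF \<eta> \<Delta> t]
    by (smt (verit))
qed

lemma sparse_partition_cover: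
  assumes \<gamma>: "0 < \<gamma>" and \<Delta>: "0 < \<Delta>" and w: "1 \<le> w" and q: "1 \<le> q"
    and M: "1 \<le> M" "2 * (2 * \<Delta> + real q * \<gamma>) \<le> (real M - 1) * \<Delta>"
    and n: "((w + 2 * q - 1) choose w) * (w * M) \<le> n"
  obtains Ps where "length Ps = n" "\<And>P. P \<in> set Ps \<Longrightarrow> partition_on (pverts G) P"
    "\<And>P C. P \<in> set Ps \<Longrightarrow> C \<in> P \<Longrightarrow> strong_diameter G wt C \<le> ereal (2 * (2 * \<Delta> + real q * \<gamma>))"
    "\<And>v. v \<in> pverts G \<Longrightarrow> \<exists>P\<in>set Ps. \<exists>C\<in>P. gball (with_proj G) wt v (real q * \<gamma> / 2) \<subseteq> C"
proof -
  define r where "r = real q * \<gamma>"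
  define K where "K = (w + 2 * q - 1) choose w"
  have r: "0 < r" using \<gamma> q by (simp add: r_def)
  have "0 < K" using q by (simp add: K_def)
  obtain col where col: "\<And>\<eta>. col \<eta> < K"
    "\<And>\<eta> \<eta>'. \<eta>' \<in> reach_upto adj (2 * q - 1) \<eta> \<Longrightarrow> \<eta>' \<noteq> \<eta> \<Longrightarrow> col \<eta>' \<noteq> (col \<eta> :: nat)"
    using colouring[OF q] unfolding K_def by blast
  have "\<exists>f. f ` {..<w} = tips (sk \<eta>)" if \<eta>: "\<eta> \<in> \<N>" for \<eta>
  proof (rule surj_lessThan_card_le)
    note sk = skeleton[OF \<eta>]
    show "finite (tips (sk \<eta>))" using sk(4) by (simp add: tips_def)
    show "tips (sk \<eta>) \<noteq> {}" using reachable_tip[OF sk(1,4)] sk(5) by blast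
    show "card (tips (sk \<eta>)) \<le> w" using card_tips_le[OF sk(1,4)] card_leaves[OF \<eta>] w by simp
  qed
  then obtain tp where tp: "\<And>\<eta>. \<eta> \<in> \<N> \<Longrightarrow> tp \<eta> ` {..<w} = tips (sk \<eta>)" by metis
  \<comment> \<open>One family for each colour \<open>c\<close>, tip index \<open>l\<close> and
    residue \<open>m\<close> of the level. Different nodes are separated by colour, different levels
    of one branch by the residue.\<close>
  define F where "F = (\<lambda>(c, l, m). {cluster r \<eta> (tp \<eta> l) k |\<eta> k.
    \<eta> \<in> \<N> \<and> col \<eta> = c \<and> k mod M = m \<and> level_set \<eta> (tp \<eta> l) k \<noteq> {}})"
  define P where "P i = F i \<union> (\<lambda>v. {v}) ` (pverts G - \<Union>(F i))" for i
  define I where "I = {..<K} \<times> {..<w} \<times> {..<M}"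
  have FE: "\<exists>\<eta> k. C = cluster r \<eta> (tp \<eta> l) k \<and> \<eta> \<in> \<N> \<and> col \<eta> = c \<and> k mod M = m \<and> level_set \<eta> (tp \<eta> l) k \<noteq> {}"
    if "C \<in> F (c, l, m)" for C c l m
    using that unfolding F_def by blast
  have part: "partition_on (pverts G) (P i)" for i
    unfolding P_def
  proof (rule partition_on_add_singletons)
    obtain c l m where i: "i = (c, l, m)" by (cases i) blast
    show "C \<noteq> {} \<and> C \<subseteq> pverts G" if CF: "C \<in> F i" for C
    proof -
      obtain \<eta> k where "C = cluster r \<eta> (tp \<eta> l) k" "\<eta> \<in> \<N>" "level_set \<eta> (tp \<eta> l) k \<noteq> {}"
        using FE[OF CF[unfolded i]] by blast
      then show ?thesis
        using cluster_nonempty[OF _ _ \<Delta>] r cluster_subset nbhd_subset_dom dom_subset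
        by (metis less_imp_le subset_trans)
    qed
    show "disjoint (F i)"
    proof (rule disjointI)
      fix C C' assume CC: "C \<in> F i" "C' \<in> F i" "C \<noteq> C'"
      obtain \<eta> k where C: "C = cluster r \<eta> (tp \<eta> l) k" "\<eta> \<in> \<N>" "col \<eta> = c" "k mod M = m"
        "level_set \<eta> (tp \<eta> l) k \<noteq> {}"
        using FE[OF CC(1)[unfolded i]] by blast
      obtain \<eta>' k' where C': "C' = cluster r \<eta>' (tp \<eta>' l) k'" "\<eta>' \<in> \<N>" "col \<eta>' = c" "k' mod M = m"
        "level_set \<eta>' (tp \<eta>' l) k' \<noteq> {}"
        using FE[OF CC(2)[unfolded i]] by blast
      show "C \<inter> C' = {}"
      proof (cases "\<eta> = \<eta>'")
        case True
        have far: "a + M \<le> b" if "a < b" "a mod M = b mod M" for a b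
        proof -
          have "M dvd b - a" using that by (metis mod_eq_dvd_iff_nat less_imp_le)
          then have "M \<le> b - a" using that(1) by (simp add: dvd_imp_le)
          then show ?thesis using that(1) by simp
        qed
        have M': "2 * (2 * \<Delta> + r) \<le> (real M - 1) * \<Delta>" using M(2) by (simp add: r_def)
        have "k \<noteq> k'" using True CC(3) C(1) C'(1) by blast
        then consider "k < k'" | "k' < k" by linarith
        then show ?thesis
        proof cases
          case 1
          show ?thesis
            using clusters_same_node_disjoint[OF C(2) \<Delta> C(5) _ far[OF 1] M'] C C' True by simp
        next
          case 2
          show ?thesis
            using clusters_same_node_disjoint[OF C(2) \<Delta> _ C(5) far[OF 2] M'] C C' True by (simp add: Int_commute)
        qed
      next
        case False
        show ?thesis
        proof (rule ccontr)
          assume "C \<inter> C' \<noteq> {}"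
          then obtain u where "u \<in> nbhd r \<eta>" "u \<in> nbhd r \<eta>'"
            using cluster_subset C(1) C'(1) by blast
          then have "\<eta>' \<in> reach_upto adj (2 * q - 1) \<eta> \<or> \<eta> \<in> reach_upto adj (2 * q - 1) \<eta>'"
            using nbhds_meet[OF C(2) C'(2) _ _ \<gamma> q] unfolding r_def by blast
          then show False using col(2) False C(3) C'(3) by metis
        qed
      qed
    qed
  qed
  have diam: "strong_diameter G wt C \<le> ereal (2 * (2 * \<Delta> + r))" if CP: "C \<in> P i" for C i
  proof -
    obtain c l m where i: "i = (c, l, m)" by (cases i) blast
    consider "C \<in> F i" | v where "C = {v}" using CP unfolding P_def by blast
    then show ?thesis
    proof cases
      case 1
      then show ?thesis using FE[of C c l m] cluster_diameter unfolding i by blast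
    next
      case 2
      have "(0 :: ereal) \<le> ereal (2 * (2 * \<Delta> + r))" using \<Delta> r by simp
      then show ?thesis using strong_diameter_singleton order_trans 2 by metis
    qed
  qed
  have cover: "\<exists>i\<in>I. \<exists>C\<in>P i. gball (with_proj G) wt v (r / 2) \<subseteq> C" if v: "v \<in> pverts G" for v
  proof -
    obtain \<eta> z k where *: "\<eta> \<in> \<N>" "z \<in> tips (sk \<eta>)" "level_set \<eta> z k \<noteq> {}"
      "gball (with_proj G) wt v (r / 2) \<subseteq> cluster r \<eta> z k"
      using ball_in_cluster[OF v less_imp_le[OF r] \<Delta>] .
    obtain l where l: "l < w" "z = tp \<eta> l" using *(1,2) tp by blast
    have "(col \<eta>, l, k mod M) \<in> I" using col(1) l(1) M(1) by (simp add: I_def)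
    moreover have "cluster r \<eta> z k \<in> P (col \<eta>, l, k mod M)"
      using * l(2) unfolding P_def F_def by blast
    ultimately show ?thesis using *(4) by blast
  qed
  have "card (P ` I) \<le> K * (w * M)"
    using card_image_le[of I P] by (simp add: I_def card_cartesian_product)
  moreover have "I \<noteq> {}" using \<open>0 < K\<close> w M(1) by (auto simp: I_def lessThan_empty_iff)
  moreover have "finite I" by (simp add: I_def)
  ultimately obtain f where f: "f ` {..<n} = P ` I"
    using surj_lessThan_card_le[of "P ` I" n] n unfolding K_def by auto
  define Ps where "Ps = map f [0..<n]"
  have set: "set Ps = P ` I" using f by (auto simp: Ps_def atLeast0LessThan)
  show ?thesis
  proof (rule that)
    show "length Ps = n" by (simp add: Ps_def)
  qed (use part diam cover in \<open>auto simp: set r_def\<close>)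
qed

end

theorem theorem4p6:
  fixes G :: "'a pair_pre_digraph" and wt :: "('a \<times> 'a) weight_fun"
    and \<Delta> \<gamma> :: real and w q :: nat
  assumes "weighted_graph G wt"
    and "admits_buffered_cop_decomposition G wt \<Delta> \<gamma> w"
    and "0 < \<gamma>" and "\<gamma> \<le> \<Delta>" and "1 \<le> w" and "1 \<le> q"
  shows "admits_strong_sparse_partition_cover G wt
           (4 * (2 * \<Delta> / (real q * \<gamma>) + 1))
           (real ((w + 2 * q - 1) choose w) * 4 * real w * (2 + real q * \<gamma> / \<Delta>))
           (2 * (2 * \<Delta> + real q * \<gamma>))"
proof -
  obtain \<rho> \<T> rt sk where "buffered_cop_decomposition G wt \<Delta> \<gamma> w \<rho> \<T> rt sk"
    using assms(2) unfolding admits_buffered_cop_decomposition_def by blast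
  then interpret cop_decomposition G wt \<Delta> \<gamma> w \<rho> \<T> rt sk
    using assms(1) by (intro cop_decomposition.intro cop_decomposition_axioms.intro)
  have \<Delta>: "0 < \<Delta>" using assms by simp
  define x where "x = real q * \<gamma> / \<Delta>"
  define K where "K = (w + 2 * q - 1) choose w"
  \<comment> \<open>\<open>M - 1\<close> has to be at least \<open>4 + 2 * x\<close>, two cluster
    radii in units of \<open>\<Delta>\<close>. The ceiling is below \<open>6 + 2 * x\<close>, hence
    at most \<open>4 * (2 + x)\<close>, the factor in the claimed number of partitions.\<close>
  define M where "M = nat \<lceil>5 + 2 * x\<rceil>"
  have x: "0 < x" "real q * \<gamma> = x * \<Delta>" using assms(3,6) \<Delta> by (simp_all add: x_def)
  have "real M = of_int \<lceil>5 + 2 * x\<rceil>" using x(1) unfolding M_def by simp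
  then have M: "5 + 2 * x \<le> real M" "real M \<le> 4 * (2 + x)"
    using x(1) ceiling_correct[of "5 + 2 * x"] by simp_all
  have M1: "1 \<le> M" using M(1) x(1) by linarith
  have "(4 + 2 * x) * \<Delta> \<le> (real M - 1) * \<Delta>" using M(1) \<Delta> by (intro mult_right_mono) auto
  then have M2: "2 * (2 * \<Delta> + real q * \<gamma>) \<le> (real M - 1) * \<Delta>" unfolding x(2) by (simp add: algebra_simps)
  have "real (K * (w * M)) = real K * real w * real M" by simp
  also have "\<dots> \<le> real K * real w * (4 * (2 + x))" using M(2) by (intro mult_left_mono) auto
  finally have "real (K * (w * M)) \<le> real K * 4 * real w * (2 + x)" by (simp add: algebra_simps)
  \<comment> \<open>The left side is an integer, so the real bound survives rounding down.\<close>
  then have n: "K * (w * M) \<le> nat \<lfloor>real K * 4 * real w * (2 + x)\<rfloor>" by linarith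
  \<comment> \<open>Diameter divided by padding parameter gives exactly the ball radius that the
    clusters cover.\<close>
  have \<beta>: "2 * (2 * \<Delta> + real q * \<gamma>) / (4 * (2 * \<Delta> / (real q * \<gamma>) + 1)) = real q * \<gamma> / 2"
    using assms(3,6) \<Delta> x by (simp add: field_simps add_nonneg_eq_0_iff)
  show ?thesis
    unfolding admits_strong_sparse_partition_cover_def strong_sparse_partition_cover_def \<beta>
    using sparse_partition_cover[OF assms(3) \<Delta> assms(5,6) M1 M2 n[unfolded K_def]]
    unfolding x_def by metis
qed

end
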